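(* Let $d\in\{1,2,3\}$. Then for every $z\in U_d$ the nearest integer continued fraction expansion $z=[0;a_{d,1}(z),a_{d,2}(z),\ldots]$ produced by the map $T_d$ is a geodesic continued fraction expansion.
   Context: Let $\omega_1=i=\sqrt{-1}$, $\omega_2=\sqrt{-2}$, $\omega_3=\frac{1+\sqrt{-3}}{2}$; $\mathbb{Z}[\omega_d]$ is the ring of integers of $\mathbb{Q}(\sqrt{-d})$. Let $U_1=\{x+yi: -\tfrac12\le x<\tfrac12,\ -\tfrac12\le y<\tfrac12\}$, $U_2=\{x+yi: -\tfrac12\le x<\tfrac12,\ -\tfrac{\sqrt2}{2}\le y<\tfrac{\sqrt2}{2}\}$, and let $U_3$ be the hexagon with vertices $(\pm\tfrac12,\pm\tfrac{1}{2\sqrt3})$, $(0,\pm\tfrac1{\sqrt3})$, including its left side and its two bottom sides together with their endpoints. The nearest integer continued fraction map is $T_d(z)=\frac1z-a_d(z)$ for $z\neq0$, $T_d(0)=0$, where $a_d(z)\in\mathbb{Z}[\omega_d]$ is chosen so that $\frac1z-a_d(z)\in U_d$. For $z\in U_d$ put $a_{d,n}(z)=a_d(T_d^{n-1}(z))$ (the expansion terminates once $T_d^n(z)=0$), giving $z=[0;a_{d,1}(z),a_{d,2}(z),\ldots]$. Continued fraction notation: $[a_0;a_1,\ldots,a_n]=a_0+\cfrac{1}{a_1+\cfrac{1}{\ddots+\cfrac{1}{a_n}}}$, and the $n$-th convergent of $[a_0;a_1,a_2,\ldots]$ is $\frac{p_n}{q_n}=[a_0;a_1,\ldots,a_n]$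 (so $\frac{p_0}{q_0}=a_0$). Farey graph: $\mathrm{PSL}(2,\mathbb{Z}[\omega_d])=\mathrm{SL}(2,\mathbb{Z}[\omega_d])/\{\pm I\}$ acts on $\mathbb{C}\cup\{\infty\}$ by Möbius transformations. The Farey graph $\mathcal{E}_d$ has vertex set $\mathbb{Q}(\sqrt{-d})\cup\{\infty\}$ and edges $A(\infty)\to A(0)$ for $A\in\mathrm{PSL}(2,\mathbb{Z}[\omega_d])$ ($z_1\to z_2$ is an edge iff $z_2\to z_1$ is). A walk is a sequence of consecutive edges, its length is the number of edges, and a geodesic path is a walk of minimal length between its endpoints. A continued fraction expansion $z=[a_0;a_1,a_2,\ldots]$ with $a_k\in\mathbb{Z}[\omega_d]$ is called geodesic if $\infty\to\frac{p_0}{q_0}\to\frac{p_1}{q_1}\to\cdots\to\frac{p_n}{q_n}$ is a geodesic path in $\mathcal{E}_d$ for every $n\ge0$ (for which the convergent is defined). *)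

theory Defs
  imports
    "HOL-Analysis.Analysis"
    "HOL-Library.Extended_Nat"
    "Graph_Theory.Vertex_Walk"
begin

definition sqrt_neg :: "nat \<Rightarrow> complex" where
  "sqrt_neg d = \<i> * of_real (sqrt (real d))"

text \<open>The definitions indexed by \<open>d\<close> are only meaningful for \<open>d \<in> {1, 2, 3}\<close>.\<close>

definition omega :: "nat \<Rightarrow> complex" where
  "omega d = (if d = 3 then (1 + sqrt_neg 3) / 2 else sqrt_neg d)"

definition quad_ints :: "nat \<Rightarrow> complex set" where
  "quad_ints d = {of_int m + of_int n * omega d | m n. True}"

definition quad_field :: "nat \<Rightarrow> complex set" where
  "quad_field d = {of_rat r + of_rat s * sqrt_neg d | r s. True}"

definition hexagon_domain :: "complex set" where
  "hexagon_domain =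
     interior (convex hull
       {Complex (1/2) (1 / (2 * sqrt 3)), Complex (1/2) (- 1 / (2 * sqrt 3)),
        Complex (- 1/2) (1 / (2 * sqrt 3)), Complex (- 1/2) (- 1 / (2 * sqrt 3)),
        Complex 0 (1 / sqrt 3), Complex 0 (- 1 / sqrt 3)})
     \<union> closed_segment (Complex (- 1/2) (1 / (2 * sqrt 3))) (Complex (- 1/2) (- 1 / (2 * sqrt 3)))
     \<union> closed_segment (Complex (- 1/2) (- 1 / (2 * sqrt 3))) (Complex 0 (- 1 / sqrt 3))
     \<union> closed_segment (Complex 0 (- 1 / sqrt 3)) (Complex (1/2) (- 1 / (2 * sqrt 3)))"

definition cf_domain :: "nat \<Rightarrow> complex set" where
  "cf_domain d =
     (if d = 1 then
        {z. - 1/2 \<le> Re z \<and> Re z < 1/2 \<and> - 1/2 \<le> Im z \<and> Im z < 1/2}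
      else if d = 2 then
        {z. - 1/2 \<le> Re z \<and> Re z < 1/2 \<and> - sqrt 2 / 2 \<le> Im z \<and> Im z < sqrt 2 / 2}
      else hexagon_domain)"


text \<open>
  The function \<open>a\<close> selects the nearest integer. For \<open>d = 1\<close> and \<open>d = 2\<close> it is determined
  on nonzero points; for \<open>d = 3\<close> the hexagon contains two representatives modulo the lattice
  of each class of corners, so there are several selections, and the digit function is kept
  as a parameter.
\<close>

definition nearest_int_choice :: "nat \<Rightarrow> (complex \<Rightarrow> complex) \<Rightarrow> bool" where
  "nearest_int_choice d a \<longleftrightarrow>
     (\<forall>z \<in> cf_domain d. z \<noteq> 0 \<longrightarrow> a z \<in> quad_ints d \<and> 1 / z - a z \<in> cf_domain d)"

definition nicf_map :: "(complex \<Rightarrow> complex) \<Rightarrow> complex \<Rightarrow> complex" where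
  "nicf_map a z = (if z = 0 then 0 else 1 / z - a z)"

definition nicf_digit :: "(complex \<Rightarrow> complex) \<Rightarrow> complex \<Rightarrow> nat \<Rightarrow> complex" where
  "nicf_digit a z n = (if n = 0 then 0 else a ((nicf_map a ^^ (n - 1)) z))"

text \<open>Index of the last digit of the expansion, \<open>\<infinity>\<close> if it does not terminate.\<close>

definition nicf_length :: "(complex \<Rightarrow> complex) \<Rightarrow> complex \<Rightarrow> enat" where
  "nicf_length a z =
     (if \<exists>n. (nicf_map a ^^ n) z = 0 then enat (LEAST n. (nicf_map a ^^ n) z = 0) else \<infinity>)"


datatype ext_complex = Fin complex | Infty

fun ext_inverse :: "ext_complex \<Rightarrow> ext_complex" where
  "ext_inverse Infty = Fin 0"
| "ext_inverse (Fin z) = (if z = 0 then Infty else Fin (1 / z))"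

fun ext_translate :: "complex \<Rightarrow> ext_complex \<Rightarrow> ext_complex" where
  "ext_translate c Infty = Infty"
| "ext_translate c (Fin z) = Fin (c + z)"

text \<open>The value of \<open>[a\<^sub>0; a\<^sub>1, \<dots>, a\<^sub>n]\<close>; the empty fraction is \<open>\<infinity>\<close>, so that \<open>[a\<^sub>0] = a\<^sub>0 + 1/\<infinity> = a\<^sub>0\<close>.\<close>

fun cf_value :: "complex list \<Rightarrow> ext_complex" where
  "cf_value [] = Infty"
| "cf_value (c # cs) = ext_translate c (ext_inverse (cf_value cs))"

definition cf_convergent :: "(nat \<Rightarrow> complex) \<Rightarrow> nat \<Rightarrow> ext_complex" where
  "cf_convergent a n = cf_value (map a [0..<Suc n])"


text \<open>Both signs of a matrix act identically, so \<open>PSL\<close> is represented by \<open>SL\<close>.\<close>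

definition SL2 :: "nat \<Rightarrow> (complex^2^2) set" where
  "SL2 d = {A. (\<forall>i j. A $ i $ j \<in> quad_ints d) \<and> det A = 1}"

fun moebius_act :: "complex^2^2 \<Rightarrow> ext_complex \<Rightarrow> ext_complex" where
  "moebius_act A Infty = (if A$2$1 = 0 then Infty else Fin (A$1$1 / A$2$1))"
| "moebius_act A (Fin z) =
     (if A$2$1 * z + A$2$2 = 0 then Infty
      else Fin (moebius (A$1$1) (A$1$2) (A$2$1) (A$2$2) z))"

definition farey_graph :: "nat \<Rightarrow> (ext_complex, ext_complex \<times> ext_complex) pre_digraph" where
  "farey_graph d =
     \<lparr>verts = insert Infty (Fin ` quad_field d),
      arcs = {(moebius_act A Infty, moebius_act A (Fin 0)) | A. A \<in> SL2 d},
      tail = fst, head = snd\<rparr>"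

definition geodesic_path :: "('a, 'b) pre_digraph \<Rightarrow> 'a list \<Rightarrow> bool" where
  "geodesic_path G p \<longleftrightarrow> vwalk p G \<and>
     (\<forall>q. vwalk q G \<and> hd q = hd p \<and> last q = last p \<longrightarrow> vwalk_length p \<le> vwalk_length q)"


text \<open>
  An expansion of \<open>z\<close> is given by digits \<open>a n\<close> for \<open>n \<le> N\<close>, where \<open>N = \<infinity>\<close> means that it is
  infinite; its values beyond \<open>N\<close> are irrelevant.
\<close>

definition cf_expansion :: "nat \<Rightarrow> complex \<Rightarrow> (nat \<Rightarrow> complex) \<Rightarrow> enat \<Rightarrow> bool" where
  "cf_expansion d z a N \<longleftrightarrow>
     (\<forall>n. enat n \<le> N \<longrightarrow> a n \<in> quad_ints d) \<and>
     (case N of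
        enat m \<Rightarrow> cf_convergent a m = Fin z
      | \<infinity> \<Rightarrow> \<forall>e>0. \<forall>\<^sub>F n in sequentially. \<exists>w. cf_convergent a n = Fin w \<and> dist w z < e)"

definition geodesic_cf_expansion :: "nat \<Rightarrow> complex \<Rightarrow> (nat \<Rightarrow> complex) \<Rightarrow> enat \<Rightarrow> bool" where
  "geodesic_cf_expansion d z a N \<longleftrightarrow>
     cf_expansion d z a N \<and>
     (\<forall>n. enat n \<le> N \<longrightarrow>
        geodesic_path (farey_graph d) (Infty # map (cf_convergent a) [0..<Suc n]))"

end

theory Submission
  imports Defs
begin

text \<open>
  The cell is bounded by bisectors of \<open>0\<close> and an integer \<open>e\<close>, and the reflections in these walls
  are automorphisms of the Farey graph. A determinant computation shows that an edge crossing a wall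
  has endpoints exchanged by its reflection, so walks can be folded along walls without getting
  longer. Hence, for a target in the closed cell, every walk from infinity may be assumed to pass
  through \<open>0\<close> next, and induction gives the minimal length.

  The convergents of a point of the cell need not lie in the cell themselves. They can leave it only
  through a wall containing the point; in that case another expansion of the same point, with some
  ties broken differently, has the reflected convergents, and as the reflection fixes infinity these
  have the same distance from it.
\<close>

section \<open>The ring of integers\<close>

lemma omega_1: "omega (Suc 0) = \<i>" and omega_2: "omega 2 = \<i> * of_real (sqrt 2)"
  and omega_3: "omega 3 = Complex (1/2) (sqrt 3 / 2)"
  by (auto simp: omega_def sqrt_neg_def complex_eq_iff)

definition omega_trace :: "nat \<Rightarrow> int" where
  "omega_trace d = (if d = 3 then 1 else 0)"

definition omega_norm :: "nat \<Rightarrow> int" where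
  "omega_norm d = (if d = 2 then 2 else 1)"

locale nicf_setting =
  fixes d :: nat
  assumes d: "d \<in> {1, 2, 3}"

context nicf_setting
begin

lemma cnj_omega: "cnj (omega d) = of_int (omega_trace d) - omega d"
  using d by (auto simp: omega_1 omega_2 omega_3 omega_trace_def complex_eq_iff)

lemma omega_squared:
  "omega d * omega d = of_int (omega_trace d) * omega d - of_int (omega_norm d)"
  using d
  by (auto simp: omega_1 omega_2 omega_3 omega_trace_def omega_norm_def complex_eq_iff)

lemma quad_intsI: "of_int m + of_int n * omega d \<in> quad_ints d"
  by (auto simp: quad_ints_def)

lemma of_int_in_quad_ints [simp]: "of_int m \<in> quad_ints d"
  using quad_intsI[of m 0] by simp

lemma zero_in_quad_ints [simp]: "0 \<in> quad_ints d"
  using of_int_in_quad_ints[of 0] by simp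

lemma one_in_quad_ints [simp]: "1 \<in> quad_ints d"
  using of_int_in_quad_ints[of 1] by simp

lemma quad_ints_add [intro]:
  assumes "x \<in> quad_ints d" "y \<in> quad_ints d"
  shows "x + y \<in> quad_ints d"
proof -
  obtain m n m' n' where "x = of_int m + of_int n * omega d" "y = of_int m' + of_int n' * omega d"
    using assms by (auto simp: quad_ints_def)
  then have "x + y = of_int (m + m') + of_int (n + n') * omega d"
    by (simp add: algebra_simps)
  then show ?thesis by (simp only: quad_intsI)
qed

lemma quad_ints_minus [intro]:
  assumes "x \<in> quad_ints d"
  shows "- x \<in> quad_ints d"
proof -
  obtain m n where "x = of_int m + of_int n * omega d"
    using assms by (auto simp: quad_ints_def)
  then have "- x = of_int (- m) + of_int (- n) * omega d"
    by (simp add: algebra_simps)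
  then show ?thesis by (simp only: quad_intsI)
qed

lemma quad_ints_diff [intro]:
  "x \<in> quad_ints d \<Longrightarrow> y \<in> quad_ints d \<Longrightarrow> x - y \<in> quad_ints d"
  using quad_ints_add[of x "- y"] by auto

lemma quad_ints_mult [intro]:
  assumes "x \<in> quad_ints d" "y \<in> quad_ints d"
  shows "x * y \<in> quad_ints d"
proof -
  obtain m n m' n' where
    xy: "x = of_int m + of_int n * omega d" "y = of_int m' + of_int n' * omega d"
    using assms by (auto simp: quad_ints_def)
  have "x * y = of_int m * of_int m' + of_int (m * n' + n * m') * omega d
      + of_int (n * n') * (omega d * omega d)"
    unfolding xy by (simp add: algebra_simps)
  also have "\<dots> = of_int (m * m' - n * n' * omega_norm d)
      + of_int (m * n' + n * m' + n * n' * omega_trace d) * omega d"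
    unfolding omega_squared by (simp add: algebra_simps)
  finally show ?thesis by (simp only: quad_intsI)
qed

lemma quad_ints_cnj [intro]:
  assumes "x \<in> quad_ints d"
  shows "cnj x \<in> quad_ints d"
proof -
  obtain m n where "x = of_int m + of_int n * omega d"
    using assms by (auto simp: quad_ints_def)
  then have "cnj x = of_int (m + n * omega_trace d) + of_int (- n) * omega d"
    by (simp add: cnj_omega algebra_simps)
  then show ?thesis by (simp only: quad_intsI)
qed

text \<open>The trace of an algebraic integer is an integer. Its parity for \<open>d = 2\<close>
  later yields divisibility by 2, the squared length of the walls \<open>omega 2\<close> and
  \<open>- omega 2\<close>.\<close>

lemma quad_ints_Re:
  assumes "x \<in> quad_ints d"
  obtains k :: int where "2 * Re x = of_int k" "d = 2 \<Longrightarrow> even k"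
proof -
  obtain m n where x: "x = of_int m + of_int n * omega d"
    using assms by (auto simp: quad_ints_def)
  have "2 * Re x = of_int (2 * m + n * omega_trace d)"
    using d unfolding x by (auto simp: omega_1 omega_2 omega_3 omega_trace_def)
  moreover have "d = 2 \<Longrightarrow> even (2 * m + n * omega_trace d)"
    by (simp add: omega_trace_def)
  ultimately show ?thesis using that by blast
qed

lemma cmod_quad_int:
  "(cmod (of_int m + of_int n * omega d))\<^sup>2
    = of_int (m\<^sup>2 + omega_trace d * m * n + omega_norm d * n\<^sup>2)"
  unfolding cmod_power2 using d
  by (auto simp: omega_1 omega_2 omega_3 omega_trace_def omega_norm_def power2_eq_square
      algebra_simps)

lemma quad_ints_cmod:
  assumes "x \<in> quad_ints d"
  obtains k :: nat where "(cmod x)\<^sup>2 = real k"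
proof -
  obtain m n where x: "x = of_int m + of_int n * omega d"
    using assms by (auto simp: quad_ints_def)
  obtain k where k: "(cmod x)\<^sup>2 = real_of_int k"
    using cmod_quad_int[of m n] unfolding x by blast
  then have "k \<ge> 0" by (metis of_int_0_le_iff zero_le_power2)
  then show ?thesis using that[of "nat k"] k by simp
qed

end

lemma unit_inverse: "cmod x = 1 \<Longrightarrow> cnj x * x = 1" for x :: complex
  by (metis complex_norm_square mult.commute of_real_1 power_one)

section \<open>The walls of the fundamental domain\<close>

text \<open>An element \<open>e\<close> stands for the perpendicular bisector of 0 and
  \<open>e\<close>. These are the Voronoi-relevant lattice vectors: the units, and for
  \<open>d = 2\<close> also the two square roots of -2.\<close>

definition walls :: "nat \<Rightarrow> complex set" where
  "walls d = {e \<in> quad_ints d. (cmod e)\<^sup>2 = 1 \<or> d = 2 \<and> (cmod e)\<^sup>2 = 2}"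

text \<open>The inequality is \<open>cmod z \<le> cmod (z - e)\<close> squared and expanded, so this
  is the closed Voronoi cell of 0. Unlike the half-open domain it is invariant under all symmetries
  of the lattice that fix 0.\<close>

definition voronoi_cell :: "nat \<Rightarrow> complex set" where
  "voronoi_cell d = {z. \<forall>e \<in> walls d. 2 * Re (cnj e * z) \<le> (cmod e)\<^sup>2}"

lemma walls_quad_ints: "e \<in> walls d \<Longrightarrow> e \<in> quad_ints d"
  and walls_nonzero: "e \<in> walls d \<Longrightarrow> e \<noteq> 0"
  by (auto simp: walls_def)

lemma walls_1:
  assumes "e \<in> walls 1"
  shows "e \<in> {1, - 1, \<i>, - \<i>}"
proof -
  obtain m n where e: "e = of_int m + of_int n * omega 1"
    using assms by (auto simp: walls_def quad_ints_def)
  have "real_of_int (m\<^sup>2 + n\<^sup>2) = 1"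
    using assms nicf_setting.cmod_quad_int[of 1 m n, OF nicf_setting.intro]
    by (auto simp: walls_def e omega_trace_def omega_norm_def)
  then have mn: "m\<^sup>2 + n\<^sup>2 = 1" by linarith
  then have "m\<^sup>2 \<le> 1" "n\<^sup>2 \<le> 1" using zero_le_power2[of m] zero_le_power2[of n] by linarith+
  then have "\<bar>m\<bar> \<le> 1" "\<bar>n\<bar> \<le> 1" by (simp_all add: abs_square_le_1)
  then have "m \<in> {-1, 0, 1}" "n \<in> {-1, 0, 1}" by auto
  then show ?thesis using mn omega_1 unfolding e by auto
qed

lemma walls_2:
  assumes "e \<in> walls 2"
  shows "e \<in> {1, - 1, omega 2, - omega 2}"
proof -
  obtain m n where e: "e = of_int m + of_int n * omega 2"
    using assms by (auto simp: walls_def quad_ints_def)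
  have "real_of_int (m\<^sup>2 + 2 * n\<^sup>2) = 1 \<or> real_of_int (m\<^sup>2 + 2 * n\<^sup>2) = 2"
    using assms nicf_setting.cmod_quad_int[of 2 m n, OF nicf_setting.intro]
    by (auto simp: walls_def e omega_trace_def omega_norm_def)
  then have mn: "m\<^sup>2 + 2 * n\<^sup>2 = 1 \<or> m\<^sup>2 + 2 * n\<^sup>2 = 2" by linarith
  then have "m\<^sup>2 \<le> 2" "n\<^sup>2 \<le> 1" using zero_le_power2[of m] zero_le_power2[of n] by linarith+
  then have "\<bar>m\<bar> < 2" "\<bar>n\<bar> \<le> 1"
    using abs_le_square_iff[of 2 m] by (force, simp add: abs_square_le_1)
  then have "m \<in> {-1, 0, 1}" "n \<in> {-1, 0, 1}" by auto
  then show ?thesis using mn unfolding e by auto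
qed

lemma walls_3:
  assumes "e \<in> walls 3"
  shows "e \<in> {1, - 1, omega 3, - omega 3, omega 3 - 1, 1 - omega 3}"
proof -
  obtain m n where e: "e = of_int m + of_int n * omega 3"
    using assms by (auto simp: walls_def quad_ints_def)
  have "real_of_int (m\<^sup>2 + m * n + n\<^sup>2) = 1"
    using assms nicf_setting.cmod_quad_int[of 3 m n, OF nicf_setting.intro]
    by (auto simp: walls_def e omega_trace_def omega_norm_def)
  then have mn: "m\<^sup>2 + m * n + n\<^sup>2 = 1" by linarith
  have "4 * (m\<^sup>2 + m * n + n\<^sup>2) = (2 * m + n)\<^sup>2 + 3 * n\<^sup>2"
    "4 * (m\<^sup>2 + m * n + n\<^sup>2) = (2 * n + m)\<^sup>2 + 3 * m\<^sup>2"
    by (simp_all add: power2_eq_square algebra_simps)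
  from this[unfolded mn] have "m\<^sup>2 \<le> 1" "n\<^sup>2 \<le> 1"
     using zero_le_power2[of "2 * m + n"] zero_le_power2[of "2 * n + m"] by linarith+
  then have "\<bar>m\<bar> \<le> 1" "\<bar>n\<bar> \<le> 1" by (simp_all add: abs_square_le_1)
  then have "m \<in> {-1, 0, 1}" "n \<in> {-1, 0, 1}" by auto
  then show ?thesis using mn unfolding e by auto
qed

context nicf_setting
begin

lemma wallI:
  assumes "m\<^sup>2 + omega_trace d * m * n + omega_norm d * n\<^sup>2 = 1
      \<or> d = 2 \<and> m\<^sup>2 + omega_trace d * m * n + omega_norm d * n\<^sup>2 = 2"
  shows "of_int m + of_int n * omega d \<in> walls d"
  using assms quad_intsI[of m n] unfolding walls_def mem_Collect_eq cmod_quad_int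
  by fastforce

lemma voronoi_cellD:
  assumes "z \<in> voronoi_cell d"
    and "m\<^sup>2 + omega_trace d * m * n + omega_norm d * n\<^sup>2 = 1
      \<or> d = 2 \<and> m\<^sup>2 + omega_trace d * m * n + omega_norm d * n\<^sup>2 = 2"
  shows "2 * Re (cnj (of_int m + of_int n * omega d) * z)
    \<le> of_int (m\<^sup>2 + omega_trace d * m * n + omega_norm d * n\<^sup>2)"
  using assms(1) wallI[OF assms(2)] unfolding voronoi_cell_def cmod_quad_int[symmetric]
  by blast

text \<open>The bound comes from \<open>d = 2\<close>, where it is attained at the corners as 1/4 +
  1/2. What matters is that it is below 1: the cell lies strictly inside the unit circle.\<close>

lemma voronoi_cell_norm:
  assumes "z \<in> voronoi_cell d"
  shows "(cmod z)\<^sup>2 \<le> 3 / 4"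
proof -
  have sq: "x\<^sup>2 \<le> c\<^sup>2" if "x \<le> c" "- x \<le> c" for x c :: real
    using that by (metis abs_le_D1 abs_le_iff abs_le_square_iff abs_of_nonneg linear order_trans)
  note D = voronoi_cellD[OF assms]
  have x: "Re z \<le> 1/2" "- Re z \<le> 1/2"
    using D[of 1 0] D[of "-1" 0] by auto
  have "(Re z)\<^sup>2 \<le> (1/2)\<^sup>2" using x by (rule sq)
  consider "d = 1" | "d = 2" | "d = 3" using d by auto
  then have "(Im z)\<^sup>2 \<le> 1/2"
  proof cases
    case 1
    have "Im z \<le> 1/2" "- Im z \<le> 1/2"
      using D[of 0 1] D[of 0 "-1"] omega_1 unfolding 1 by (auto simp: omega_trace_def omega_norm_def)
    then have "(Im z)\<^sup>2 \<le> (1/2)\<^sup>2" by (rule sq)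
    then show ?thesis by (simp add: power2_eq_square)
  next
    case 2
    have "sqrt 2 * Im z \<le> 1" "- (sqrt 2 * Im z) \<le> 1"
      using D[of 0 1] D[of 0 "-1"] omega_2 unfolding 2 by (auto simp: omega_trace_def omega_norm_def)
    then have "(sqrt 2 * Im z)\<^sup>2 \<le> 1\<^sup>2" by (rule sq)
    then show ?thesis by (simp add: power_mult_distrib)
  next
    case 3
    \<comment> \<open>Adding the inequalities of two neighbouring walls eliminates the real
      part.\<close>
    have "sqrt 3 * Im z \<le> 1" "- (sqrt 3 * Im z) \<le> 1"
      using D[of 0 1] D[of 0 "-1"] D[of "-1" 1] D[of "1" "-1"] omega_3 unfolding 3
      by (auto simp: omega_trace_def omega_norm_def)
    then have "(sqrt 3 * Im z)\<^sup>2 \<le> 1\<^sup>2" by (rule sq)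
    then show ?thesis by (simp add: power_mult_distrib)
  qed
  with \<open>(Re z)\<^sup>2 \<le> (1/2)\<^sup>2\<close> show ?thesis
    unfolding cmod_power2 by (simp add: power_divide)
qed

text \<open>0 is the only lattice point in its closed Voronoi cell, since the wall inequalities
  force both integer coordinates to vanish.\<close>

lemma quad_int_beyond_wall:
  assumes "x \<in> quad_ints d" "x \<noteq> 0"
  obtains e where "e \<in> walls d" "2 * Re (cnj e * x) > (cmod e)\<^sup>2"
proof -
  have "x \<notin> voronoi_cell d"
  proof
    assume "x \<in> voronoi_cell d"
    note D = voronoi_cellD[OF this]
    obtain m n where x: "x = of_int m + of_int n * omega d"
      using assms by (auto simp: quad_ints_def)
    consider "d = 1" | "d = 2" | "d = 3" using d by auto
    then have "m = 0 \<and> n = 0"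
    proof cases
      case 1
      then show ?thesis
        using D[of 1 0] D[of "-1" 0] D[of 0 1] D[of 0 "-1"] unfolding x 1
        by (auto simp: omega_1 omega_trace_def omega_norm_def)
    next
      case 2
      have s: "sqrt 2 * (real_of_int n * sqrt 2) = 2 * real_of_int n" by simp
      show ?thesis
        using D[of 1 0] D[of "-1" 0] D[of 0 1] D[of 0 "-1"] unfolding x 2
        by (auto simp: omega_2 s omega_trace_def omega_norm_def)
    next
      case 3
      then show ?thesis
        using D[of 1 0] D[of "-1" 0] D[of 0 1] D[of 0 "-1"] D[of "-1" 1] D[of "1" "-1"] unfolding x 3
        by (auto simp: omega_3 omega_trace_def omega_norm_def algebra_simps)
    qed
    then show False using assms(2) x by simp
  qed
  then show ?thesis using that by (force simp: voronoi_cell_def)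
qed

end

text \<open>The cell is an intersection of half-planes, hence convex, so it suffices to check the
  six vertices.\<close>

lemma hexagon_domain_subset: "hexagon_domain \<subseteq> voronoi_cell 3"
proof -
  let ?V = "{Complex (1/2) (1 / (2 * sqrt 3)), Complex (1/2) (- 1 / (2 * sqrt 3)),
        Complex (- 1/2) (1 / (2 * sqrt 3)), Complex (- 1/2) (- 1 / (2 * sqrt 3)),
        Complex 0 (1 / sqrt 3), Complex 0 (- 1 / sqrt 3)}"
  have V: "?V \<subseteq> voronoi_cell 3"
    unfolding voronoi_cell_def using walls_3 omega_3
    by (fastforce simp: walls_def cmod_power2 power2_eq_square field_simps)
  have "voronoi_cell 3 = (\<Inter>e \<in> walls 3. {z. e \<bullet> z \<le> (cmod e)\<^sup>2 / 2})"
    by (auto simp: voronoi_cell_def inner_complex_def algebra_simps)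
  then have "convex (voronoi_cell 3)"
    by (simp only: convex_INT convex_halfspace_le)
  with V have hull: "convex hull ?V \<subseteq> voronoi_cell 3"
    by (rule hull_minimal)
  have seg: "closed_segment a b \<subseteq> voronoi_cell 3" if "a \<in> ?V" "b \<in> ?V" for a b
    using that V \<open>convex (voronoi_cell 3)\<close> by (meson closed_segment_subset subsetD)
  show ?thesis
    unfolding hexagon_domain_def
    using hull interior_subset[of "convex hull ?V"] by (intro Un_least seg) auto
qed

lemma (in nicf_setting) cf_domain_subset:
  "cf_domain d \<subseteq> voronoi_cell d"
proof -
  consider "d = 1" | "d = 2" | "d = 3" using d by auto
  then show ?thesis
  proof cases
    case 1
    then show ?thesis using walls_1 by (fastforce simp: cf_domain_def voronoi_cell_def)
  next
    case 2
    have "sqrt 2 * x \<le> 1" if "x < sqrt 2 / 2" for x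
      using mult_left_mono[of x "sqrt 2 / 2" "sqrt 2"] that by simp
    moreover have "- (sqrt 2 * x) \<le> 1" if "- (sqrt 2 / 2) \<le> x" for x
      using mult_left_mono[of "- (sqrt 2 / 2)" x "sqrt 2"] that by simp
    ultimately show ?thesis using walls_2 omega_2 unfolding 2
      by (fastforce simp: cf_domain_def voronoi_cell_def cmod_power2)
  next
    case 3
    then show ?thesis using hexagon_domain_subset by (simp add: cf_domain_def)
  qed
qed

section \<open>The Farey graph and its reflections\<close>

text \<open>The point of the projective line with homogeneous coordinates
  \<open>(p, q)\<close>.\<close>

definition ratio :: "complex \<Rightarrow> complex \<Rightarrow> ext_complex" where
  "ratio p q = (if q = 0 then Infty else Fin (p / q))"

abbreviation farey_adj :: "nat \<Rightarrow> ext_complex rel" where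
  "farey_adj d \<equiv> arcs_ends (farey_graph d)"

lemma ratio_scale: "k \<noteq> 0 \<Longrightarrow> ratio (k * p) (k * q) = ratio p q"
  by (simp add: ratio_def)

lemma farey_adj_iff:
  "(x, y) \<in> farey_adj d \<longleftrightarrow>
    (\<exists>p q r s. {p, q, r, s} \<subseteq> quad_ints d \<and> p * s - r * q = 1 \<and> x = ratio p q \<and> y = ratio r s)"
proof
  assume "(x, y) \<in> farey_adj d"
  then obtain A where A: "A \<in> SL2 d" "x = moebius_act A Infty" "y = moebius_act A (Fin 0)"
    by (auto simp: farey_graph_def arcs_ends_def arc_to_ends_def)
  have "x = ratio (A$1$1) (A$2$1)" "y = ratio (A$1$2) (A$2$2)"
    using A by (auto simp: ratio_def moebius_def)
  moreover have "A$1$1 * A$2$2 - A$1$2 * A$2$1 = 1" "{A$1$1, A$2$1, A$1$2, A$2$2} \<subseteq> quad_ints d"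
    using A(1) by (auto simp: SL2_def det_2)
  ultimately show "\<exists>p q r s. {p, q, r, s} \<subseteq> quad_ints d \<and> p * s - r * q = 1
      \<and> x = ratio p q \<and> y = ratio r s"
    by blast
next
  assume "\<exists>p q r s. {p, q, r, s} \<subseteq> quad_ints d \<and> p * s - r * q = 1 \<and> x = ratio p q \<and> y = ratio r s"
  then obtain p q r s where *: "{p, q, r, s} \<subseteq> quad_ints d" "p * s - r * q = 1"
    "x = ratio p q" "y = ratio r s" by blast
  define A :: "complex^2^2" where "A = vector [vector [p, r], vector [q, s]]"
  have A: "A$1$1 = p" "A$1$2 = r" "A$2$1 = q" "A$2$2 = s"
    by (simp_all add: A_def)
  have "A \<in> SL2 d"
    using * by (auto simp: SL2_def det_2 A forall_2)
  moreover have "x = moebius_act A Infty" "y = moebius_act A (Fin 0)"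
    using * by (auto simp: A ratio_def moebius_def)
  ultimately show "(x, y) \<in> farey_adj d"
    by (force simp: farey_graph_def arcs_ends_def arc_to_ends_def)
qed

context nicf_setting
begin

text \<open>A determinant that is a unit suffices, as one column can be multiplied by its inverse.
  Inversion and reflections produce such determinants.\<close>

lemma farey_adj_ratio:
  assumes "{p, q, r, s} \<subseteq> quad_ints d" "cmod (p * s - r * q) = 1"
  shows "(ratio p q, ratio r s) \<in> farey_adj d"
proof -
  define u where "u = cnj (p * s - r * q)"
  have "cmod u = 1" using assms(2) by (simp only: u_def complex_mod_cnj)
  then have "u \<noteq> 0" by auto
  have "p * (u * s) - (u * r) * q = u * (p * s - r * q)" by (simp add: algebra_simps)
  also have "\<dots> = 1" unfolding u_def by (rule unit_inverse[OF assms(2)])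
  finally have "p * (u * s) - (u * r) * q = 1" .
  moreover have "u \<in> quad_ints d" using assms(1) unfolding u_def by (intro quad_ints_cnj) auto
  ultimately show ?thesis
    using assms ratio_scale[OF \<open>u \<noteq> 0\<close>, of r s] unfolding farey_adj_iff
    by (intro exI[of _ p] exI[of _ q] exI[of _ "u * r"] exI[of _ "u * s"]) auto
qed

lemma (in -) farey_adjE:
  assumes "(x, y) \<in> farey_adj d"
  obtains p q r s where "{p, q, r, s} \<subseteq> quad_ints d" "p * s - r * q = 1"
    "x = ratio p q" "y = ratio r s"
  using assms unfolding farey_adj_iff by blast

lemma farey_adj_translate:
  assumes "c \<in> quad_ints d" "(x, y) \<in> farey_adj d"
  shows "(ext_translate c x, ext_translate c y) \<in> farey_adj d"
proof -
  obtain p q r s where *: "{p, q, r, s} \<subseteq> quad_ints d" "p * s - r * q = 1"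
    "x = ratio p q" "y = ratio r s" using assms(2) by (rule farey_adjE)
  have t: "ext_translate c (ratio p q) = ratio (p + c * q) q" for p q
    by (simp add: ratio_def field_simps)
  have "(p + c * q) * s - (r + c * s) * q = 1"
    using *(2) by (simp add: algebra_simps)
  then have "cmod ((p + c * q) * s - (r + c * s) * q) = 1" by simp
  then show ?thesis
    unfolding *(3,4) t using assms * by (intro farey_adj_ratio) auto
qed

lemma farey_adj_inverse:
  assumes "(x, y) \<in> farey_adj d"
  shows "(ext_inverse x, ext_inverse y) \<in> farey_adj d"
proof -
  obtain p q r s where *: "{p, q, r, s} \<subseteq> quad_ints d" "p * s - r * q = 1"
    "x = ratio p q" "y = ratio r s" using assms(1) by (rule farey_adjE)
  have "ext_inverse x = ratio q p" "ext_inverse y = ratio s r"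
    using *(2-4) by (auto simp: ratio_def)
  moreover have "q * r - s * p = - 1"
    using *(2) by (simp add: algebra_simps)
  then have "cmod (q * r - s * p) = 1" by simp
  ultimately show ?thesis
    using assms * by (auto intro: farey_adj_ratio)
qed

end

section \<open>Reflections in the walls and folding of walks\<close>

fun wall_reflect :: "complex \<Rightarrow> ext_complex \<Rightarrow> ext_complex" where
  "wall_reflect e Infty = Infty"
| "wall_reflect e (Fin z) = Fin (e - e / cnj e * cnj z)"

text \<open>Positive on the side of 0, negative beyond the bisector. The value 0 at infinity
  expresses that every wall is a line through infinity, which \<open>wall_reflect\<close>
  fixes.\<close>

fun wall_side :: "complex \<Rightarrow> ext_complex \<Rightarrow> real" where
  "wall_side e Infty = 0"
| "wall_side e (Fin z) = (cmod e)\<^sup>2 - 2 * Re (cnj e * z)"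

context nicf_setting
begin

text \<open>For a unit \<open>e\<close> the quotient is \<open>e * e\<close>; for the square roots
  of -2 it is -1. Hence the reflections have integral coefficients.\<close>

lemma wall_unit:
  assumes "e \<in> walls d"
  shows "e / cnj e \<in> quad_ints d" "cmod (e / cnj e) = 1"
proof -
  show "cmod (e / cnj e) = 1"
    using walls_nonzero[OF assms] by (simp add: norm_divide)
  show "e / cnj e \<in> quad_ints d"
  proof (cases "cmod e = 1")
    case True
    then have "e / cnj e = e * e"
      using unit_inverse[of e] walls_nonzero[OF assms] by (simp add: field_simps)
    then show ?thesis using walls_quad_ints[OF assms] by auto
  next
    case False
    then have d: "d = 2" and e: "(cmod e)\<^sup>2 = 2"
      using assms norm_ge_zero[of e] by (auto simp: walls_def power2_eq_1_iff simp del: norm_ge_zero)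
    from False have "e \<in> {omega 2, - omega 2}"
      using walls_2[of e] assms unfolding d by auto
    then have "e / cnj e = of_int (- 1)"
      by (auto simp: omega_2)
    then show ?thesis by (simp only: of_int_in_quad_ints)
  qed
qed

text \<open>In homogeneous coordinates a reflection is conjugation followed by an integral linear
  map, so it changes determinants only by conjugation and a unit factor.\<close>

lemma farey_adj_reflect:
  assumes "e \<in> walls d" "(x, y) \<in> farey_adj d"
  shows "(wall_reflect e x, wall_reflect e y) \<in> farey_adj d"
proof -
  obtain p q r s where *: "{p, q, r, s} \<subseteq> quad_ints d" "p * s - r * q = 1"
    "x = ratio p q" "y = ratio r s" using assms(2) by (rule farey_adjE)
  define u where "u = e / cnj e"
  have u: "u \<in> quad_ints d" "cmod u = 1"
    unfolding u_def by (rule wall_unit[OF assms(1)])+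
  have t: "wall_reflect e (ratio p q) = ratio (e * cnj q - u * cnj p) (cnj q)" for p q
    by (simp add: ratio_def u_def diff_divide_distrib)
  have "(e * cnj q - u * cnj p) * cnj s - (e * cnj s - u * cnj r) * cnj q
      = - u * cnj (p * s - r * q)"
    by (simp add: algebra_simps)
  then have "cmod ((e * cnj q - u * cnj p) * cnj s - (e * cnj s - u * cnj r) * cnj q) = 1"
    using *(2) u by (simp add: norm_mult)
  then show ?thesis
    unfolding *(3,4) t using assms * u walls_quad_ints[OF assms(1)]
    by (intro farey_adj_ratio) auto
qed

text \<open>Up to the factor \<open>(cmod q)\<^sup>2\<close> the side function is a Hermitian form
  in \<open>(p, q)\<close>. Its values at integers are multiples of \<open>(cmod e)\<^sup>2\<close>;
  when this is 2, the parity of the trace is the reason.\<close>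

lemma wall_side_ratio:
  assumes "e \<in> walls d" "p \<in> quad_ints d" "q \<in> quad_ints d" "q \<noteq> 0"
  obtains k :: int where
    "(cmod e)\<^sup>2 * (cmod q)\<^sup>2 - 2 * Re (cnj e * p * cnj q) = (cmod e)\<^sup>2 * of_int k"
    "wall_side e (ratio p q) = (cmod e)\<^sup>2 * of_int k / (cmod q)\<^sup>2"
proof -
  have eR: "e \<in> quad_ints d" using assms by (simp add: walls_quad_ints)
  then have "cnj e * p * cnj q \<in> quad_ints d"
    using assms by auto
  then obtain m where m: "2 * Re (cnj e * p * cnj q) = of_int m" "d = 2 \<Longrightarrow> even m"
    using quad_ints_Re by blast
  obtain n where n: "(cmod q)\<^sup>2 = real n"
    using quad_ints_cmod assms by blast
  have "\<exists>k. (cmod e)\<^sup>2 * (cmod q)\<^sup>2 - 2 * Re (cnj e * p * cnj q) = (cmod e)\<^sup>2 * of_int k"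
  proof (cases "(cmod e)\<^sup>2 = 1")
    case True
    then show ?thesis using m n by (intro exI[of _ "int n - m"]) simp
  next
    case False
    then have "d = 2" and e: "(cmod e)\<^sup>2 = 2"
      using assms by (auto simp: walls_def)
    then show ?thesis using m n by (auto elim!: evenE intro!: exI[of _ "int n - m div 2"])
  qed
  then obtain k where
    k: "(cmod e)\<^sup>2 * (cmod q)\<^sup>2 - 2 * Re (cnj e * p * cnj q) = (cmod e)\<^sup>2 * of_int k" ..
  have "cnj e * (p / q) = cnj e * p * cnj q / of_real ((cmod q)\<^sup>2)"
    unfolding complex_norm_square using \<open>q \<noteq> 0\<close> by (simp add: field_simps)
  then have "Re (cnj e * (p / q)) = Re (cnj e * p * cnj q) / (cmod q)\<^sup>2"
    by (metis Re_divide_of_real)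
  then have "wall_side e (ratio p q)
      = ((cmod e)\<^sup>2 * (cmod q)\<^sup>2 - 2 * Re (cnj e * p * cnj q)) / (cmod q)\<^sup>2"
    using \<open>q \<noteq> 0\<close> by (simp add: ratio_def field_simps)
  then show ?thesis unfolding k by (rule that[OF k])
qed

text \<open>The Hermitian form defining the wall has determinant \<open>-(cmod e)\<^sup>2\<close>, so its Gram matrix on
  the endpoints of an edge has this determinant too; the diagonal entries are multiples of
  \<open>(cmod e)\<^sup>2\<close>, and if they have opposite signs the off-diagonal entry must vanish.\<close>

lemma farey_adj_crossing:
  assumes e: "e \<in> walls d" and "(x, y) \<in> farey_adj d"
    and side: "wall_side e x < 0" "wall_side e y > 0"
  shows "wall_reflect e x = y"
proof -
  obtain p q r s where *: "{p, q, r, s} \<subseteq> quad_ints d" "p * s - r * q = 1"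
    "x = ratio p q" "y = ratio r s" using assms(2) by (rule farey_adjE)
  have nz: "q \<noteq> 0" "s \<noteq> 0" "e \<noteq> 0"
    using side walls_nonzero[OF e] unfolding *(3,4) by (auto simp: ratio_def)
  define D where "D = (cmod e)\<^sup>2"
  have D: "D \<ge> 1" using e by (auto simp: walls_def D_def)
  obtain k where k: "D * (cmod q)\<^sup>2 - 2 * Re (cnj e * p * cnj q) = D * of_int k"
    "wall_side e (ratio p q) = D * of_int k / (cmod q)\<^sup>2"
    using wall_side_ratio[OF e, of p q] * nz unfolding D_def by auto
  obtain l where l: "D * (cmod s)\<^sup>2 - 2 * Re (cnj e * r * cnj s) = D * of_int l"
    "wall_side e (ratio r s) = D * of_int l / (cmod s)\<^sup>2"
    using wall_side_ratio[OF e, of r s] * nz unfolding D_def by auto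
  have "k \<le> - 1" "l \<ge> 1"
    using side k(2) l(2) nz D unfolding *(3,4)
    by (auto simp: divide_less_0_iff zero_less_divide_iff mult_less_0_iff zero_less_mult_iff)
  then have "k * l \<le> - 1"
    using mult_mono[of 1 "- k" 1 l] by simp
  \<comment> \<open>The off-diagonal Gram entry; \<open>h = 0\<close> says that \<open>r / s\<close>
    is the reflection of \<open>p / q\<close>.\<close>
  define h where "h = of_real D * s * cnj q - e * s * cnj p - cnj e * r * cnj q"
  have cD: "complex_of_real D = e * cnj e"
    unfolding D_def by (rule complex_norm_square)
  have two_Re: "of_real 2 * of_real (Re z) = z + cnj z" for z
    by (simp add: complex_add_cnj)
  have "complex_of_real ((D * of_int k) * (D * of_int l) - (cmod h)\<^sup>2)
      = - (e * cnj e) * (p * s - r * q) * cnj (p * s - r * q)"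
    unfolding k(1)[symmetric] l(1)[symmetric] h_def
    by (simp only: of_real_diff of_real_mult two_Re cD complex_norm_square
        complex_cnj_mult complex_cnj_diff complex_cnj_cnj) (simp add: algebra_simps)
  also have "\<dots> = complex_of_real (- D)" using *(2) cD by simp
  finally have "(D * of_int k) * (D * of_int l) - (cmod h)\<^sup>2 = - D"
    by (simp only: of_real_eq_iff)
  then have "(cmod h)\<^sup>2 = D * (1 + D * of_int (k * l))"
    by (simp add: algebra_simps)
  moreover have "D * of_int (k * l) \<le> D * - 1"
    using D \<open>k * l \<le> - 1\<close> by (intro mult_left_mono) (linarith, simp)
  then have "D * (1 + D * of_int (k * l)) \<le> 0"
    using D by (intro mult_nonneg_nonpos) auto
  ultimately have "(cmod h)\<^sup>2 \<le> 0" by (simp only:)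
  then have "h = 0" by simp
  then have "r * cnj e * cnj q = e * s * (cnj e * cnj q - cnj p)"
    unfolding h_def cD by (simp add: algebra_simps)
  then show ?thesis
    unfolding *(3,4) using nz by (simp add: ratio_def field_simps)
qed

lemma wall_reflect_fixed:
  assumes "e \<in> walls d" "wall_side e x = 0"
  shows "wall_reflect e x = x"
proof (cases x)
  case (Fin z)
  have "complex_of_real ((cmod e)\<^sup>2) = complex_of_real (2 * Re (cnj e * z))"
    using assms(2) Fin by simp
  then have "e * cnj e = cnj e * z + e * cnj z"
    unfolding complex_norm_square by (simp only: complex_add_cnj[symmetric]) simp
  then show ?thesis
    using Fin walls_nonzero[OF assms(1)] by (simp add: field_simps)
qed simp

text \<open>Reflection exchanges 0 and \<open>e\<close>, so the reflected point is as far from 0 as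
  \<open>z\<close> is from \<open>e\<close>; beyond the wall, \<open>e\<close> is nearer than
  0.\<close>

lemma cmod_wall_reflect:
  assumes "e \<in> walls d" "2 * Re (cnj e * z) > (cmod e)\<^sup>2"
  shows "cmod (e - e / cnj e * cnj z) < cmod z"
proof -
  have "e - e / cnj e * cnj z = e / cnj e * cnj (e - z)"
    using walls_nonzero[OF assms(1)] by (simp add: field_simps)
  then have "cmod (e - e / cnj e * cnj z) = cmod (e - z)"
    using wall_unit(2)[OF assms(1)] by (simp only: norm_mult complex_mod_cnj)
  moreover have "(cmod (e - z))\<^sup>2 = (cmod e)\<^sup>2 - 2 * Re (cnj e * z) + (cmod z)\<^sup>2"
    unfolding cmod_power2 by (simp add: power2_eq_square algebra_simps)
  ultimately show ?thesis
    using assms(2) by (smt (verit) norm_ge_zero power_mono)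
qed

text \<open>Reflect the walk until it first meets or crosses the wall. A crossing edge collapses,
  because its end is the reflection of its start.\<close>

lemma walk_fold:
  assumes "e \<in> walls d" "(x, y) \<in> farey_adj d ^^ n"
    and "wall_side e x \<le> 0" "wall_side e y \<ge> 0"
  shows "\<exists>m \<le> n. (wall_reflect e x, y) \<in> farey_adj d ^^ m"
  using assms(2,3)
proof (induction n arbitrary: x)
  case 0
  then show ?case
    using assms wall_reflect_fixed[OF assms(1)] by (intro exI[of _ 0]) simp
next
  case (Suc n)
  from Suc.prems(1) obtain v where v: "(x, v) \<in> farey_adj d" "(v, y) \<in> farey_adj d ^^ n"
    by (rule relpow_Suc_E2)
  consider "wall_side e x = 0" | "wall_side e v \<le> 0" | "wall_side e x < 0" "wall_side e v > 0"
    using Suc.prems(2) by linarith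
  then show ?case
  proof cases
    case 1
    then show ?thesis
      using Suc.prems(1) wall_reflect_fixed[OF assms(1)] by (metis order_refl)
  next
    case 2
    then obtain m where "m \<le> n" "(wall_reflect e v, y) \<in> farey_adj d ^^ m"
      using Suc.IH v(2) by blast
    then show ?thesis
      using farey_adj_reflect[OF assms(1) v(1)] by (meson Suc_le_mono relpow_Suc_I2)
  next
    case 3
    then show ?thesis
      using farey_adj_crossing[OF assms(1) v(1)] v(2) by (metis le_SucI order_refl)
  qed
qed

text \<open>Descent on the norm of \<open>b\<close>: a nonzero \<open>b\<close> lies beyond some
  wall, while \<open>t\<close> does not, and folding there replaces \<open>b\<close> by an integer
  of smaller norm without lengthening the walk.\<close>

lemma walk_from_zero:
  assumes "t \<in> voronoi_cell d" "b \<in> quad_ints d" "(Fin b, Fin t) \<in> farey_adj d ^^ n"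
  shows "\<exists>m \<le> n. (Fin 0, Fin t) \<in> farey_adj d ^^ m"
proof -
  obtain k where "(cmod b)\<^sup>2 = real k" using assms(2) by (rule quad_ints_cmod)
  then show ?thesis using assms(2,3)
  proof (induction k arbitrary: b n rule: less_induct)
    case (less k)
    show ?case
    proof (cases "b = 0")
      case True
      then show ?thesis using less.prems by blast
    next
      case False
      then obtain e where e: "e \<in> walls d" "2 * Re (cnj e * b) > (cmod e)\<^sup>2"
        using quad_int_beyond_wall less.prems(2) by blast
      have "wall_side e (Fin b) \<le> 0" "wall_side e (Fin t) \<ge> 0"
        using e assms(1) by (auto simp: voronoi_cell_def)
      then obtain m where m: "m \<le> n" "(wall_reflect e (Fin b), Fin t) \<in> farey_adj d ^^ m"
        using walk_fold[OF e(1) less.prems(3)] by blast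
      define b' where "b' = e - e / cnj e * cnj b"
      have b': "b' \<in> quad_ints d"
        unfolding b'_def using wall_unit(1) walls_quad_ints e(1) less.prems(2)
        by (intro quad_ints_diff quad_ints_mult quad_ints_cnj) auto
      then obtain l where l: "(cmod b')\<^sup>2 = real l" by (rule quad_ints_cmod)
      have "cmod b' < cmod b"
        unfolding b'_def by (rule cmod_wall_reflect[OF e])
      then have "l < k" using l less.prems(1)
        by (metis norm_ge_zero of_nat_less_iff power_strict_mono zero_less_numeral)
      then obtain m' where "m' \<le> m" "(Fin 0, Fin t) \<in> farey_adj d ^^ m'"
        using less.IH[OF _ l b'] m(2) unfolding b'_def by auto
      then show ?thesis using m(1) by (meson order_trans)
    qed
  qed
qed

end

section \<open>Nearest integer expansions with arbitrary choice on the boundary\<close>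

text \<open>\<open>nicf d z l t\<close>: the number \<open>t = [0; a\<^sub>1, \<dots>, a\<^sub>l]\<close> is the convergent of a nearest integer
  expansion of \<open>z\<close>, where ties on the boundary of the cell are broken in an arbitrary way.\<close>

inductive nicf :: "nat \<Rightarrow> complex \<Rightarrow> nat \<Rightarrow> complex \<Rightarrow> bool" for d where
  nicf_0: "z \<in> voronoi_cell d \<Longrightarrow> nicf d z 0 0"
| nicf_Suc: "z \<in> voronoi_cell d \<Longrightarrow> z \<noteq> 0 \<Longrightarrow> a \<in> quad_ints d \<Longrightarrow> nicf d (1 / z - a) l t
    \<Longrightarrow> nicf d z (Suc l) (1 / (a + t))"

inductive_cases nicf_0E: "nicf d z 0 t"
inductive_cases nicf_SucE: "nicf d z (Suc l) t"

lemma nicf_cell: "nicf d z l t \<Longrightarrow> z \<in> voronoi_cell d"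
  by (auto elim: nicf.cases)

section \<open>Integral Hermitian forms and the images of the walls\<close>

definition hform :: "int \<Rightarrow> complex \<Rightarrow> int \<Rightarrow> complex \<Rightarrow> real" where
  "hform \<alpha> \<beta> \<gamma> z = of_int \<alpha> * (cmod z)\<^sup>2 + 2 * Re (cnj \<beta> * z) + of_int \<gamma>"

text \<open>The sesquilinear form with diagonal \<open>hform\<close>. Zero sets of indefinite forms
  are circles and lines, which inversion and translation permute.\<close>

definition hpolar :: "int \<Rightarrow> complex \<Rightarrow> int \<Rightarrow> complex \<Rightarrow> complex \<Rightarrow> complex" where
  "hpolar \<alpha> \<beta> \<gamma> x y = of_int \<alpha> * x * cnj y + cnj \<beta> * x + \<beta> * cnj y + of_int \<gamma>"

text \<open>The forms of the images of the walls \<open>2 * Re (cnj e * z) = (cmod e)\<^sup>2\<close> under the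
  extended Bianchi group, where \<open>D = (cmod e)\<^sup>2\<close>; \<open>hpolar \<alpha> \<beta> \<gamma> x y = 0\<close> says that \<open>x\<close> is the
  reflection of \<open>y\<close>.\<close>

definition wall_form :: "nat \<Rightarrow> int \<Rightarrow> int \<Rightarrow> complex \<Rightarrow> int \<Rightarrow> bool" where
  "wall_form d D \<alpha> \<beta> \<gamma> \<longleftrightarrow> (D = 1 \<or> d = 2 \<and> D = 2) \<and> D dvd \<alpha> \<and> D dvd \<gamma> \<and> \<beta> \<in> quad_ints d
    \<and> (cmod \<beta>)\<^sup>2 = of_int (\<alpha> * \<gamma> + D)"

lemma hform_inverse:
  assumes "w \<noteq> 0"
  shows "hform \<alpha> \<beta> \<gamma> (1 / w) = hform \<gamma> (cnj \<beta>) \<alpha> w / (cmod w)\<^sup>2"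
proof -
  have "cnj \<beta> * (1 / w) = cnj (\<beta> * w) / of_real ((cmod w)\<^sup>2)"
    unfolding complex_norm_square using assms by (simp add: field_simps)
  then have "Re (cnj \<beta> * (1 / w)) = Re (\<beta> * w) / (cmod w)\<^sup>2"
    by (metis Re_divide_of_real complex_cnj(1) complex_cnj_cnj complex_surj complex.sel(1))
  then show ?thesis
    unfolding hform_def using assms by (simp add: norm_divide power_divide field_simps)
qed

lemma hpolar_inverse:
  assumes "v \<noteq> 0" "w \<noteq> 0"
  shows "hpolar \<alpha> \<beta> \<gamma> (1 / v) (1 / w) = hpolar \<gamma> (cnj \<beta>) \<alpha> v w / (v * cnj w)"
  unfolding hpolar_def using assms by (simp add: field_simps)

text \<open>The constant coefficient in coordinates centred at \<open>a\<close> is the value at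
  \<open>a\<close>, so its sign shows on which side \<open>a\<close> lies.\<close>

lemma hform_translate:
  assumes "of_int \<delta> = hform \<alpha> \<beta> \<gamma> a"
  shows "hform \<alpha> \<beta> \<gamma> (a + x) = hform \<alpha> (\<beta> + of_int \<alpha> * a) \<delta> x"
  using assms unfolding hform_def cmod_power2 by (simp add: power2_eq_square algebra_simps)

lemma hform_eq_hpolar: "complex_of_real (hform \<alpha> \<beta> \<gamma> x) = hpolar \<alpha> \<beta> \<gamma> x x"
  unfolding hform_def hpolar_def of_real_add of_real_mult complex_norm_square
  using complex_add_cnj[of "cnj \<beta> * x"] by (simp add: algebra_simps)

lemma hpolar_translate:
  assumes "of_int \<delta> = hform \<alpha> \<beta> \<gamma> a"
  shows "hpolar \<alpha> \<beta> \<gamma> (a + x) (a + y) = hpolar \<alpha> (\<beta> + of_int \<alpha> * a) \<delta> x y"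
proof -
  have "of_int \<delta> = hpolar \<alpha> \<beta> \<gamma> a a"
    using assms hform_eq_hpolar by (metis of_real_of_int_eq)
  then show ?thesis by (simp add: hpolar_def algebra_simps)
qed

context nicf_setting
begin

text \<open>Up to a positive factor, the substitution \<open>z = 1 / (a + y)\<close> turns a wall
  form in \<open>z\<close> into this form in \<open>y\<close>. The determinant is preserved, and
  divisibility by \<open>D = 2\<close> follows from the parity of traces.\<close>

lemma wall_form_step:
  assumes "wall_form d D \<alpha> \<beta> \<gamma>" "a \<in> quad_ints d"
  obtains \<delta> where "of_int \<delta> = hform \<gamma> (cnj \<beta>) \<alpha> a" "wall_form d D \<gamma> (cnj \<beta> + of_int \<gamma> * a) \<delta>"
proof -
  have \<beta>: "\<beta> \<in> quad_ints d" "(cmod \<beta>)\<^sup>2 = of_int (\<alpha> * \<gamma> + D)" and D: "D = 1 \<or> d = 2 \<and> D = 2"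
    and dv: "D dvd \<alpha>" "D dvd \<gamma>"
    using assms by (auto simp: wall_form_def)
  have "\<beta> * a \<in> quad_ints d" using \<beta> assms(2) by auto
  then obtain m where m: "2 * Re (\<beta> * a) = of_int m" "d = 2 \<Longrightarrow> even m"
    using quad_ints_Re by blast
  obtain n where n: "(cmod a)\<^sup>2 = real n"
    using quad_ints_cmod assms(2) by blast
  define \<delta> where "\<delta> = \<gamma> * int n + m + \<alpha>"
  have \<delta>: "of_int \<delta> = hform \<gamma> (cnj \<beta>) \<alpha> a"
    using m n by (simp add: hform_def \<delta>_def)
  have "D dvd m" using D m by auto
  then have "D dvd \<delta>" using dv by (simp add: \<delta>_def)
  have "(cmod (cnj \<beta> + of_int \<gamma> * a))\<^sup>2
      = (cmod \<beta>)\<^sup>2 + of_int \<gamma> * (2 * Re (\<beta> * a)) + of_int \<gamma> * of_int \<gamma> * (cmod a)\<^sup>2"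
    unfolding cmod_power2 by (simp add: power2_eq_square algebra_simps)
  also have "\<dots> = of_int (\<gamma> * \<delta> + D)"
    unfolding \<beta>(2) m(1) n by (simp add: \<delta>_def algebra_simps)
  finally have "(cmod (cnj \<beta> + of_int \<gamma> * a))\<^sup>2 = of_int (\<gamma> * \<delta> + D)" .
  moreover have "cnj \<beta> + of_int \<gamma> * a \<in> quad_ints d"
    using \<beta>(1) assms(2) by (intro quad_ints_add quad_ints_mult quad_ints_cnj) auto
  ultimately have "wall_form d D \<gamma> (cnj \<beta> + of_int \<gamma> * a) \<delta>"
    using D dv \<open>D dvd \<delta>\<close> unfolding wall_form_def by blast
  with \<delta> show ?thesis by (rule that)
qed

text \<open>A wall that has an integer \<open>a\<close> on its negative side and a point of \<open>a + voronoi_cell d\<close> on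
  its closed positive side is, after translation by \<open>-a\<close>, one of the walls of the cell.\<close>

lemma wall_form_negative:
  assumes "wall_form d D \<gamma> \<beta> \<delta>" "\<gamma> \<ge> 0" "\<delta> < 0" "x \<in> voronoi_cell d" "hform \<gamma> \<beta> \<delta> x \<ge> 0"
  shows "\<gamma> = 0" "\<delta> = - D" "\<beta> \<in> walls d" "(cmod \<beta>)\<^sup>2 = of_int D" "2 * Re (cnj \<beta> * x) = of_int D"
proof -
  have D: "D = 1 \<or> d = 2 \<and> D = 2" and dv: "D dvd \<gamma>" "D dvd \<delta>"
    and \<beta>: "\<beta> \<in> quad_ints d" "(cmod \<beta>)\<^sup>2 = of_int (\<gamma> * \<delta> + D)"
    using assms(1) by (auto simp: wall_form_def)
  have "\<delta> \<le> - D"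
    using dv(2) assms(3) D zdvd_imp_le[of D "- \<delta>"] by auto
  have "\<gamma> * \<delta> + D \<ge> 0"
    using \<beta>(2) by (metis of_int_0_le_iff zero_le_power2)
  show "\<gamma> = 0"
  proof (rule ccontr)
    assume "\<gamma> \<noteq> 0"
    then have "\<gamma> \<ge> 1" using assms(2) by simp
    have "\<gamma> * D \<le> \<gamma> * (- \<delta>)"
      using \<open>\<delta> \<le> - D\<close> assms(2) by (intro mult_left_mono) auto
    then have "\<gamma> * D \<le> 1 * D" using \<open>\<gamma> * \<delta> + D \<ge> 0\<close> by simp
    then have "\<gamma> \<le> 1" using D by (subst (asm) mult_le_cancel_right) auto
    then have "\<gamma> = 1" using \<open>\<gamma> \<ge> 1\<close> by simp
    then have "D = 1" using dv(1) D by auto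
    then have "\<delta> = - 1" using \<open>\<gamma> * \<delta> + D \<ge> 0\<close> \<open>\<gamma> = 1\<close> \<open>\<delta> \<le> - D\<close> by simp
    \<comment> \<open>What remains is the unit circle, which strictly encloses the cell.\<close>
    then have "\<beta> = 0" using \<beta>(2) \<open>\<gamma> = 1\<close> \<open>D = 1\<close> by simp
    then have "(cmod x)\<^sup>2 \<ge> 1"
      using assms(5) \<open>\<gamma> = 1\<close> \<open>\<delta> = - 1\<close> by (simp add: hform_def)
    then show False using voronoi_cell_norm[OF assms(4)] by simp
  qed
  then show \<beta>D: "(cmod \<beta>)\<^sup>2 = of_int D" using \<beta> by simp
  then show "\<beta> \<in> walls d" using D \<beta>(1) by (auto simp: walls_def)
  then have "2 * Re (cnj \<beta> * x) \<le> of_int D"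
    using assms(4) \<beta>D by (auto simp: voronoi_cell_def)
  moreover have "2 * Re (cnj \<beta> * x) \<ge> - of_int \<delta>"
    using assms(5) \<open>\<gamma> = 0\<close> by (simp add: hform_def)
  ultimately show "\<delta> = - D" "2 * Re (cnj \<beta> * x) = of_int D"
    using \<open>\<delta> \<le> - D\<close> by linarith+
qed

text \<open>For \<open>a = 0\<close> the point \<open>1 / z\<close> is too large. For a unit
  \<open>a\<close>, the wall \<open>cnj a\<close> gives
  \<open>cmod (1 - a * z) \<ge> cmod z\<close>, whereas the bound on \<open>1 / z - a\<close> makes
  the left side smaller.\<close>

lemma digit_norm:
  assumes "z \<in> voronoi_cell d" "z \<noteq> 0" "a \<in> quad_ints d" "1 / z - a \<in> voronoi_cell d"
  shows "(cmod a)\<^sup>2 \<ge> 2"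
proof -
  obtain n where n: "(cmod a)\<^sup>2 = real n" using assms(3) by (rule quad_ints_cmod)
  have z: "(cmod z)\<^sup>2 > 0" "(cmod z)\<^sup>2 \<le> 3 / 4"
    using assms(2) voronoi_cell_norm[OF assms(1)] by auto
  have "1 / z - a = (1 - a * z) / z" using assms(2) by (simp add: field_simps)
  then have "(cmod (1 / z - a))\<^sup>2 = (cmod (1 - a * z))\<^sup>2 / (cmod z)\<^sup>2"
    by (simp add: norm_divide power_divide)
  then have "(cmod (1 - a * z))\<^sup>2 = (cmod (1 / z - a))\<^sup>2 * (cmod z)\<^sup>2"
    using z(1) by (simp add: field_simps)
  also have "\<dots> \<le> 3 / 4 * (cmod z)\<^sup>2"
    using voronoi_cell_norm[OF assms(4)] by (intro mult_right_mono) auto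
  finally have le: "(cmod (1 - a * z))\<^sup>2 \<le> 3 / 4 * (cmod z)\<^sup>2" .
  have "n \<noteq> 0"
  proof
    assume "n = 0"
    then have "a = 0" using n by simp
    then show False using le z(2) by simp
  qed
  moreover have "n \<noteq> 1"
  proof
    assume "n = 1"
    then have "cnj a \<in> walls d" using assms(3) n by (auto simp: walls_def)
    then have "2 * Re (a * z) \<le> 1"
      using assms(1) n \<open>n = 1\<close> by (force simp: voronoi_cell_def)
    moreover have "(cmod (1 - a * z))\<^sup>2 = 1 - 2 * Re (a * z) + (cmod a)\<^sup>2 * (cmod z)\<^sup>2"
      unfolding power_mult_distrib[symmetric] norm_mult[symmetric] unfolding cmod_power2
      by (simp add: power2_eq_square algebra_simps)
    ultimately show False using le z n \<open>n = 1\<close> by simp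
  qed
  ultimately show ?thesis using n by simp
qed

text \<open>Conjugation followed by multiplication by a unit \<open>u\<close> is a symmetry of the
  lattice and the cell. Taking reciprocals turns \<open>u\<close> into \<open>cnj u\<close>, hence
  the induction over all \<open>u\<close>.\<close>

lemma nicf_symmetry:
  assumes "nicf d z l t" "u \<in> quad_ints d" "cmod u = 1"
  shows "nicf d (u * cnj z) l (u * cnj t)"
proof -
  have cell: "u * cnj z \<in> voronoi_cell d"
    if "z \<in> voronoi_cell d" "u \<in> quad_ints d" "cmod u = 1" for u z
    unfolding voronoi_cell_def
  proof (intro CollectI ballI)
    fix e assume e: "e \<in> walls d"
    have "u * cnj e \<in> quad_ints d"
      using that walls_quad_ints[OF e] by (intro quad_ints_mult quad_ints_cnj)
    then have "u * cnj e \<in> walls d"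
      using e that by (auto simp: walls_def norm_mult)
    then have "2 * Re (cnj (u * cnj e) * z) \<le> (cmod (u * cnj e))\<^sup>2"
      using that(1) unfolding voronoi_cell_def by blast
    moreover have "Re (cnj (u * cnj e) * z) = Re (cnj e * (u * cnj z))"
      by (simp add: algebra_simps)
    ultimately show "2 * Re (cnj e * (u * cnj z)) \<le> (cmod e)\<^sup>2"
      using that(3) by (simp only: norm_mult complex_mod_cnj) simp
  qed
  show ?thesis using assms
  proof (induction arbitrary: u rule: nicf.induct)
    case (nicf_0 z)
    then show ?case using cell nicf.nicf_0[of "u * cnj z" d] by simp
  next
    case (nicf_Suc z a l t)
    have "u \<noteq> 0" using nicf_Suc.prems(2) by auto
    then have inv: "1 / u = cnj u"
      using unit_inverse[OF nicf_Suc.prems(2)] by (simp add: field_simps)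
    have "nicf d (cnj u * cnj (1 / z - a)) l (cnj u * cnj t)"
      using nicf_Suc.IH[of "cnj u"] nicf_Suc.prems quad_ints_cnj by simp
    moreover have "cnj u * cnj (1 / z - a) = 1 / (u * cnj z) - cnj u * cnj a"
      by (simp add: algebra_simps flip: inv)
    ultimately have "nicf d (u * cnj z) (Suc l) (1 / (cnj u * cnj a + cnj u * cnj t))"
      using nicf_Suc cell \<open>u \<noteq> 0\<close> by (intro nicf.nicf_Suc) auto
    moreover have "1 / (cnj u * cnj a + cnj u * cnj t) = u * cnj (1 / (a + t))"
      using \<open>u \<noteq> 0\<close> by (simp add: add_divide_distrib[symmetric] flip: inv)
    ultimately show ?case by simp
  qed
qed

text \<open>The convergents of a point on the positive side of a wall stay there, unless the point lies
  on the wall; then breaking a later tie differently reflects the convergent.\<close>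

lemma nicf_fold:
  assumes "nicf d z l t" "wall_form d D \<alpha> \<beta> \<gamma>" "\<gamma> \<ge> 0" "hform \<alpha> \<beta> \<gamma> z \<ge> 0"
  shows "hform \<alpha> \<beta> \<gamma> t \<ge> 0 \<or> hform \<alpha> \<beta> \<gamma> z = 0
    \<and> (\<exists>t'. nicf d z l t' \<and> hform \<alpha> \<beta> \<gamma> t' \<ge> 0 \<and> hpolar \<alpha> \<beta> \<gamma> t' t = 0)"
  using assms
proof (induction l arbitrary: z t D \<alpha> \<beta> \<gamma>)
  case 0
  then show ?case by (auto elim!: nicf_0E simp: hform_def)
next
  case (Suc l)
  from Suc.prems(1) obtain a s where z: "z \<in> voronoi_cell d" "z \<noteq> 0" and a: "a \<in> quad_ints d"
    and s: "nicf d (1 / z - a) l s" and t: "t = 1 / (a + s)"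
    by (rule nicf_SucE)
  define y where "y = 1 / z - a"
  have zy: "z = 1 / (a + y)" "a + y \<noteq> 0" using z(2) by (auto simp: y_def)
  have s: "nicf d y l s" using s by (simp add: y_def)
  \<comment> \<open>The form of the unit circle, positive inside, is a wall form. For it the
    induction hypothesis bounds convergents of the tail by 1, while digits are longer, so no
    denominator vanishes.\<close>
  have nz: "b + x \<noteq> 0" if b: "b \<in> quad_ints d" "nicf d (1 / z - b) l x" for b x
  proof -
    have "wall_form d 1 (- 1) 0 1" by (simp add: wall_form_def)
    moreover have "hform (- 1) 0 1 (1 / z - b) > 0"
      using voronoi_cell_norm[OF nicf_cell[OF b(2)]] by (simp add: hform_def)
    ultimately have "hform (- 1) 0 1 x \<ge> 0"
      using Suc.IH[OF b(2), of 1 "- 1" 0 1] by auto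
    then have "(cmod x)\<^sup>2 \<le> 1" by (simp add: hform_def)
    moreover have "(cmod b)\<^sup>2 \<ge> 2"
      using digit_norm[OF z b(1) nicf_cell[OF b(2)]] .
    ultimately show ?thesis
      by (auto simp: add_eq_0_iff)
  qed
  obtain \<delta> where \<delta>: "of_int \<delta> = hform \<gamma> (cnj \<beta>) \<alpha> a"
    and form: "wall_form d D \<gamma> (cnj \<beta> + of_int \<gamma> * a) \<delta>"
    using wall_form_step[OF Suc.prems(2) a] by blast
  define \<beta>' where "\<beta>' = cnj \<beta> + of_int \<gamma> * a"
  have tr: "hform \<alpha> \<beta> \<gamma> (1 / (a + x)) = hform \<gamma> \<beta>' \<delta> x / (cmod (a + x))\<^sup>2" if "a + x \<noteq> 0" for x
    using that by (simp add: hform_inverse hform_translate[OF \<delta>] \<beta>'_def)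
  have tr_polar: "hpolar \<alpha> \<beta> \<gamma> (1 / (a + x)) (1 / (a + x')) = 0"
    if "a + x \<noteq> 0" "a + x' \<noteq> 0" "hpolar \<gamma> \<beta>' \<delta> x x' = 0" for x x'
    using that(3) unfolding hpolar_inverse[OF that(1,2)] hpolar_translate[OF \<delta>] \<beta>'_def by simp
  have y0: "hform \<gamma> \<beta>' \<delta> y \<ge> 0"
    using Suc.prems(4) zy(2) unfolding zy(1) tr[OF zy(2)] by (simp add: zero_le_divide_iff)
  have as: "a + s \<noteq> 0" using nz a s by (simp add: y_def)
  show ?case
  proof (cases "hform \<gamma> \<beta>' \<delta> s \<ge> 0")
    case True
    then show ?thesis unfolding t tr[OF as] by simp
  next
    case s_neg: False
    show ?thesis
    \<comment> \<open>\<open>\<gamma>\<close> and \<open>\<delta>\<close> are the values at 0 of the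
      forms in \<open>z\<close> and in \<open>y\<close>, and \<open>\<delta>\<close> is also a value
      at \<open>a\<close>. If \<open>a\<close> is not on the negative side, the induction hypothesis
      applies to \<open>y\<close>; otherwise the transformed wall bounds the cell.\<close>
    proof (cases "\<delta> \<ge> 0")
      case True
      then obtain s' where s': "hform \<gamma> \<beta>' \<delta> y = 0" "nicf d y l s'" "hform \<gamma> \<beta>' \<delta> s' \<ge> 0"
        "hpolar \<gamma> \<beta>' \<delta> s' s = 0"
        using Suc.IH[OF s form[folded \<beta>'_def] True y0] s_neg by auto
      have as': "a + s' \<noteq> 0" using nz a s'(2) by (simp add: y_def)
      have "nicf d z (Suc l) (1 / (a + s'))"
        using z a s'(2) by (auto intro: nicf_Suc simp: y_def)
      moreover have "hform \<alpha> \<beta> \<gamma> z = 0" unfolding zy(1) tr[OF zy(2)] s'(1) by simp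
      moreover have "hform \<alpha> \<beta> \<gamma> (1 / (a + s')) \<ge> 0" using s'(3) unfolding tr[OF as'] by simp
      ultimately show ?thesis
        using tr_polar[OF as' as s'(4)] unfolding t by blast
    next
      case False
      then have "\<delta> < 0" by simp
      note neg = wall_form_negative[OF form[folded \<beta>'_def] Suc.prems(3) this nicf_cell[OF s] y0]
      \<comment> \<open>The point \<open>y\<close> lies on the wall \<open>\<beta>'\<close>, so
        \<open>a\<close> and \<open>a + \<beta>'\<close> are tied as digits. Changing the digit
        replaces \<open>y\<close> by \<open>y - \<beta>' = u * cnj y\<close>, which is expanded by
        symmetry.\<close>
      define u where "u = - (\<beta>' / cnj \<beta>')"
      have u: "u \<in> quad_ints d" "cmod u = 1"
        unfolding u_def using wall_unit[OF neg(3)] by auto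
      have "\<beta>' \<noteq> 0" using neg(3) walls_nonzero by blast
      have "wall_reflect \<beta>' (Fin y) = Fin y"
        using neg by (intro wall_reflect_fixed) auto
      then have uy: "u * cnj y = 1 / z - (a + \<beta>')"
        by (simp add: u_def y_def algebra_simps)
      have a': "a + \<beta>' \<in> quad_ints d" using a neg(3) walls_quad_ints by auto
      have nicf': "nicf d (1 / z - (a + \<beta>')) l (u * cnj s)"
        using nicf_symmetry[OF s u] unfolding uy .
      then have as': "a + (\<beta>' + u * cnj s) \<noteq> 0"
        using nz[OF a'] by (simp add: add.assoc)
      \<comment> \<open>\<open>\<beta>' + u * cnj s\<close> is the reflection of \<open>s\<close> in
        the wall \<open>\<beta>'\<close>. Since \<open>\<gamma> = 0\<close>, the form is affine and
        changes sign under it.\<close>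
      have refl: "cnj \<beta>' * (\<beta>' + u * cnj s) = of_int D - \<beta>' * cnj s"
      proof -
        have "\<beta>' * cnj \<beta>' = of_int D"
          using neg(4) complex_norm_square[of \<beta>'] by (metis of_real_of_int_eq)
        then show ?thesis using \<open>\<beta>' \<noteq> 0\<close> by (simp add: u_def algebra_simps)
      qed
      have "hpolar \<gamma> \<beta>' \<delta> (\<beta>' + u * cnj s) s = 0"
        unfolding hpolar_def using neg refl by simp
      then have "hpolar \<alpha> \<beta> \<gamma> (1 / (a + (\<beta>' + u * cnj s))) t = 0"
        unfolding t using as as' by (intro tr_polar)
      moreover have "hform \<gamma> \<beta>' \<delta> (\<beta>' + u * cnj s) = - hform \<gamma> \<beta>' \<delta> s"
        unfolding hform_def refl neg(1,2) by (simp add: algebra_simps)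
      then have "hform \<alpha> \<beta> \<gamma> (1 / (a + (\<beta>' + u * cnj s))) \<ge> 0"
        unfolding tr[OF as'] using s_neg by (intro divide_nonneg_nonneg) auto
      moreover have "nicf d z (Suc l) (1 / (a + (\<beta>' + u * cnj s)))"
        using nicf_Suc[OF z a' nicf'] by (simp add: add.assoc)
      moreover have "hform \<gamma> \<beta>' \<delta> y = 0"
        unfolding hform_def using neg by simp
      then have "hform \<alpha> \<beta> \<gamma> z = 0" unfolding zy(1) tr[OF zy(2)] by simp
      ultimately show ?thesis by blast
    qed
  qed
qed

text \<open>The unit circle has a wall form and \<open>z\<close> lies strictly inside, which
  excludes the reflected alternative of \<open>nicf_fold\<close>.\<close>

lemma nicf_cmod:
  assumes "nicf d z l t"
  shows "cmod t \<le> 1"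
proof -
  have "wall_form d 1 (- 1) 0 1" by (simp add: wall_form_def)
  moreover have "hform (- 1) 0 1 z > 0"
    using voronoi_cell_norm[OF nicf_cell[OF assms]] by (simp add: hform_def)
  ultimately have "hform (- 1) 0 1 t \<ge> 0"
    using nicf_fold[OF assms, of 1 "- 1" 0 1] by auto
  then show ?thesis by (simp add: hform_def abs_square_le_1)
qed

lemma nicf_digit_nonzero:
  assumes "z \<in> voronoi_cell d" "z \<noteq> 0" "a \<in> quad_ints d" "nicf d (1 / z - a) l t"
  shows "a + t \<noteq> 0"
proof
  assume "a + t = 0"
  then have "cmod a = cmod t" by (simp add: add_eq_0_iff)
  then have "(cmod a)\<^sup>2 \<le> 1" using nicf_cmod[OF assms(4)] by (simp add: abs_square_le_1)
  then show False using digit_norm[OF assms(1-3) nicf_cell[OF assms(4)]] by simp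
qed

text \<open>With \<open>y = 1 / z - a\<close> the error is
  \<open>1 / (a + t) - z = (y - t) * z / (a + t)\<close>. Here
  \<open>cmod z \<le> sqrt (3 / 4)\<close> and the convergent has modulus at most 1, so each digit
  contracts the error.\<close>

lemma nicf_dist:
  assumes "nicf d z l t"
  shows "dist t z \<le> sqrt (3 / 4) ^ l"
  using assms
proof (induction rule: nicf.induct)
  case (nicf_0 z)
  then have "(cmod z)\<^sup>2 \<le> 1" using voronoi_cell_norm by force
  then show ?case by (simp add: abs_square_le_1)
next
  case (nicf_Suc z a l t)
  have nz: "a + t \<noteq> 0" using nicf_Suc nicf_digit_nonzero by blast
  have "cmod z \<le> sqrt (3 / 4)"
    using voronoi_cell_norm[OF nicf_Suc(1)] by (rule real_le_rsqrt)
  moreover have "cmod (1 / (a + t)) \<le> 1"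
    using nicf_Suc nicf.nicf_Suc nicf_cmod by blast
  ultimately have "cmod z * cmod (1 / (a + t)) \<le> sqrt (3 / 4) * 1"
    by (intro mult_mono) auto
  moreover have "1 / (a + t) - z = ((1 / z - a) - t) * (z * (1 / (a + t)))"
    using nz \<open>z \<noteq> 0\<close> unfolding diff_diff_eq left_diff_distrib by simp
  then have "dist (1 / (a + t)) z = dist t (1 / z - a) * (cmod z * cmod (1 / (a + t)))"
    by (simp only: dist_norm norm_mult) (simp add: norm_minus_commute)
  ultimately have "dist (1 / (a + t)) z \<le> sqrt (3 / 4) ^ l * (sqrt (3 / 4) * 1)"
    using nicf_Suc.IH by (simp only:) (rule mult_mono; simp)
  then show ?case by (simp add: mult.commute)
qed

end

section \<open>Convergents and geodesics\<close>

lemma relpow_map: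
  assumes "\<And>x y. (x, y) \<in> R \<Longrightarrow> (f x, f y) \<in> R" "(x, y) \<in> R ^^ n"
  shows "(f x, f y) \<in> R ^^ n"
  using assms(2)
proof (induction n arbitrary: y)
  case (Suc n)
  then show ?case using assms(1) by (auto 4 4)
qed simp

context nicf_setting
begin

lemma farey_adj_Infty:
  assumes "(Infty, y) \<in> farey_adj d"
  obtains b where "b \<in> quad_ints d" "y = Fin b"
proof -
  obtain p q r s where *: "{p, q, r, s} \<subseteq> quad_ints d" "p * s - r * q = 1"
    "Infty = ratio p q" "y = ratio r s" using assms by (rule farey_adjE)
  have "q = 0" using *(3) by (auto simp: ratio_def split: if_splits)
  then have ps: "p * s = 1" using *(2) by simp
  then have "s \<noteq> 0" by auto
  moreover have "r / s = r * p" using ps \<open>s \<noteq> 0\<close> by (simp add: field_simps)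
  moreover have "r * p \<in> quad_ints d" using *(1) by auto
  ultimately show ?thesis using that *(4) by (simp add: ratio_def)
qed

text \<open>Supplies a denominator of \<open>t\<close>, so that a descent on the modulus of
  \<open>t\<close> can be measured by the natural number
  \<open>(cmod (q * t))\<^sup>2\<close>.\<close>

lemma walk_end_ratio:
  assumes "(Infty, Fin t) \<in> farey_adj d ^^ n"
  obtains q where "q \<in> quad_ints d" "q \<noteq> 0" "q * t \<in> quad_ints d"
proof -
  obtain m where "n = Suc m" using assms by (cases n) auto
  then obtain v where "(v, Fin t) \<in> farey_adj d" using assms by auto
  then obtain p q r s where *: "{p, q, r, s} \<subseteq> quad_ints d" "Fin t = ratio r s"
    by (rule farey_adjE)
  then have "s \<noteq> 0" "s * t = r" by (auto simp: ratio_def split: if_splits)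
  then show ?thesis using that * by auto
qed

text \<open>The first edge leads to an integer, which folding moves to 0; the strict inequality
  accounts for that edge.\<close>

lemma walk_to_cell:
  assumes "t \<in> voronoi_cell d" "(Infty, Fin t) \<in> farey_adj d ^^ n"
  obtains m where "m < n" "(Fin 0, Fin t) \<in> farey_adj d ^^ m"
proof -
  obtain k where k: "n = Suc k" using assms(2) by (cases n) auto
  then obtain v where v: "(Infty, v) \<in> farey_adj d" "(v, Fin t) \<in> farey_adj d ^^ k"
    using assms(2) relpow_Suc_D2 by metis
  from v(1) obtain b where "b \<in> quad_ints d" "v = Fin b" by (rule farey_adj_Infty)
  then show ?thesis using walk_from_zero[OF assms(1)] v(2) that k by (metis le_imp_less_Suc)
qed

text \<open>The outer induction removes one digit once \<open>t\<close> is in the cell. The inner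
  induction brings \<open>t\<close> there by reflections, which decrease the norm of
  \<open>q * t\<close> and, by \<open>nicf_fold\<close>, lead to convergents of \<open>z\<close>
  with the same number of digits.\<close>

lemma nicf_walk_length:
  assumes "nicf d z l t" "(Infty, Fin t) \<in> farey_adj d ^^ n"
  shows "Suc l \<le> n"
  using assms
proof (induction l arbitrary: z t n)
  case 0
  then show ?case by (cases n) auto
next
  case (Suc l)
  obtain q where q: "q \<in> quad_ints d" "q \<noteq> 0" "q * t \<in> quad_ints d"
    using Suc.prems(2) by (rule walk_end_ratio)
  obtain k where k: "(cmod (q * t))\<^sup>2 = real k" using q(3) by (rule quad_ints_cmod)
  show ?case using Suc.prems q k
  proof (induction k arbitrary: t q rule: less_induct)
    case (less k)
    note walk = less.prems(2) and q = less.prems(3-5)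
    show ?case
    proof (cases "t \<in> voronoi_cell d")
      case True
      then obtain m where m: "m < n" "(Fin 0, Fin t) \<in> farey_adj d ^^ m"
        using walk by (rule walk_to_cell)
      from less.prems(1) obtain a s where z: "z \<in> voronoi_cell d" "z \<noteq> 0"
        and a: "a \<in> quad_ints d" and s: "nicf d (1 / z - a) l s" and t: "t = 1 / (a + s)"
        by (rule nicf_SucE)
      have as: "a + s \<noteq> 0" using nicf_digit_nonzero[OF z a s] .
      \<comment> \<open>Inversion followed by translation by \<open>- a\<close> is an automorphism
        taking 0 to infinity and \<open>t\<close> to \<open>s\<close>.\<close>
      have "(ext_inverse (Fin 0), ext_inverse (Fin t)) \<in> farey_adj d ^^ m"
        using m(2) by (rule relpow_map[where f = ext_inverse, rotated]) (rule farey_adj_inverse)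
      then have "(Infty, Fin (a + s)) \<in> farey_adj d ^^ m"
        using as by (simp add: t)
      then have "(ext_translate (- a) Infty, ext_translate (- a) (Fin (a + s))) \<in> farey_adj d ^^ m"
        by (rule relpow_map[where f = "ext_translate (- a)", rotated])
          (rule farey_adj_translate[OF quad_ints_minus[OF a]])
      then have "(Infty, Fin s) \<in> farey_adj d ^^ m" by simp
      then show ?thesis using Suc.IH[OF s] m(1) by fastforce
    next
      case False
      then obtain e where e: "e \<in> walls d" "2 * Re (cnj e * t) > (cmod e)\<^sup>2"
        by (force simp: voronoi_cell_def)
      obtain D where D: "(cmod e)\<^sup>2 = of_int D" "D = 1 \<or> d = 2 \<and> D = 2"
        using e(1) that[of 1] that[of 2] by (auto simp: walls_def)
      \<comment> \<open>On finite points this form is \<open>wall_side e\<close>.\<close>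
      have "wall_form d D 0 (- e) D"
        using D quad_ints_minus[OF walls_quad_ints[OF e(1)]] by (auto simp: wall_form_def)
      moreover have "hform 0 (- e) D z \<ge> 0"
        using nicf_cell[OF less.prems(1)] e(1) D(1) by (auto simp: hform_def voronoi_cell_def)
      moreover have "hform 0 (- e) D t < 0"
        using e(2) D(1) by (simp add: hform_def)
      ultimately obtain t' where t': "nicf d z (Suc l) t'" "hpolar 0 (- e) D t' t = 0"
        using nicf_fold[OF less.prems(1), of D 0 "- e" D] D(2) by auto
      have "e * cnj e = of_int D"
        using D(1) complex_norm_square[of e] by (metis of_real_of_int_eq)
      then have "cnj e * t' = e * cnj e - e * cnj t"
        using t'(2) by (simp add: hpolar_def algebra_simps)
      then have t'_eq: "t' = e - e / cnj e * cnj t"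
        using walls_nonzero[OF e(1)] by (simp add: field_simps)
      have "(wall_reflect e Infty, wall_reflect e (Fin t)) \<in> farey_adj d ^^ n"
        using walk by (rule relpow_map[where f = "wall_reflect e", rotated])
          (rule farey_adj_reflect[OF e(1)])
      then have walk': "(Infty, Fin t') \<in> farey_adj d ^^ n" by (simp add: t'_eq)
      \<comment> \<open>\<open>cnj q\<close> is a denominator of the reflected point and has the
        modulus of \<open>q\<close>, so the norm drops together with the modulus of the
        point.\<close>
      have "cnj q * t' = cnj q * e - e / cnj e * cnj (q * t)"
        by (simp add: t'_eq algebra_simps)
      moreover have "cnj q * e - e / cnj e * cnj (q * t) \<in> quad_ints d"
        using quad_ints_cnj[OF q(1)] quad_ints_cnj[OF q(3)] wall_unit(1)[OF e(1)]
          walls_quad_ints[OF e(1)]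
        by (intro quad_ints_diff quad_ints_mult)
      ultimately have q': "cnj q * t' \<in> quad_ints d" by simp
      then obtain k' where k': "(cmod (cnj q * t'))\<^sup>2 = real k'" by (rule quad_ints_cmod)
      have "cmod t' < cmod t" unfolding t'_eq by (rule cmod_wall_reflect[OF e])
      then have "cmod (cnj q * t') < cmod (q * t)" using q(2) by (simp add: norm_mult)
      then have "k' < k" using k' less.prems(6)
        by (metis norm_ge_zero of_nat_less_iff power_strict_mono zero_less_numeral)
      then show ?thesis
        using less.IH[OF _ t'(1) walk' _ _ q' k'] q by auto
    qed
  qed
qed

text \<open>Vertices are specified independently of arcs, so the ends of arcs have to be placed in
  the field; rationalising the denominator does this.\<close>

lemma ratio_vertex:
  assumes "r \<in> quad_ints d" "s \<in> quad_ints d"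
  shows "ratio r s \<in> verts (farey_graph d)"
proof (cases "s = 0")
  case True
  then show ?thesis by (simp add: ratio_def farey_graph_def)
next
  case False
  have "r * cnj s \<in> quad_ints d" using assms by auto
  then obtain m n where mn: "r * cnj s = of_int m + of_int n * omega d"
    by (auto simp: quad_ints_def)
  obtain N where N: "(cmod s)\<^sup>2 = real N" using assms(2) by (rule quad_ints_cmod)
  have "s * cnj s = of_nat N"
    using N complex_norm_square[of s] by (metis of_real_of_nat_eq)
  then have "r / s = r * cnj s / of_nat N"
    using False by (metis complex_cnj_zero_iff mult_divide_mult_cancel_right)
  then have rs: "r / s = (of_int m + of_int n * omega d) / of_nat N" unfolding mn .
  obtain x y where "omega d = of_rat x + of_rat y * sqrt_neg d"
  proof (cases "d = 3")
    case True
    then show ?thesis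
      using that[of "1/2" "1/2"] by (simp add: omega_def of_rat_divide field_simps)
  next
    case False
    then show ?thesis using that[of 0 1] by (simp add: omega_def)
  qed
  then have "r / s = of_rat ((of_int m + of_int n * x) / of_nat N)
      + of_rat (of_int n * y / of_nat N) * sqrt_neg d"
    unfolding rs by (simp add: of_rat_add of_rat_mult of_rat_divide add_divide_distrib
        distrib_left distrib_right)
  then have "r / s \<in> quad_field d" unfolding quad_field_def by blast
  then show ?thesis using False by (simp add: ratio_def farey_graph_def)
qed

lemma farey_adj_vertices:
  assumes "(x, y) \<in> farey_adj d"
  shows "x \<in> verts (farey_graph d)" "y \<in> verts (farey_graph d)"
  using assms by (auto elim!: farey_adjE intro: ratio_vertex)

text \<open>The base edge joins infinity to the integer \<open>c\<close>; each digit put in front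
  applies an inversion and a translation, both automorphisms of the graph.\<close>

lemma cf_value_adj:
  assumes "set cs \<subseteq> quad_ints d" "c \<in> quad_ints d"
  shows "(cf_value cs, cf_value (cs @ [c])) \<in> farey_adj d"
  using assms(1)
proof (induction cs)
  case Nil
  have "(ratio 1 0, ratio c 1) \<in> farey_adj d"
    using assms(2) by (intro farey_adj_ratio) auto
  then show ?case by (simp add: ratio_def)
next
  case (Cons b cs)
  then show ?case by (auto intro: farey_adj_translate farey_adj_inverse)
qed

end

section \<open>Walks as vertex lists, and the expansion produced by the digit function\<close>

lemma vwalk_map_upt:
  assumes "\<And>k. k \<le> n \<Longrightarrow> f k \<in> verts G" "\<And>k. k < n \<Longrightarrow> (f k, f (Suc k)) \<in> arcs_ends G"
  shows "vwalk (map f [0..<Suc n]) G"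
  using assms
proof (induction n)
  case 0
  then show ?case by (auto simp: vwalk_def)
next
  case (Suc n)
  have "vwalk (map f [0..<Suc n]) G" using Suc by auto
  moreover have "map f [0..<Suc (Suc n)] = map f [0..<Suc n] @ [f (Suc n)]" by simp
  moreover have "last (map f [0..<Suc n]) = f n" by simp
  moreover have "map f [0..<Suc n] \<noteq> []" by simp
  ultimately show ?case
    using Suc.prems(1)[of "Suc n"] Suc.prems(2)[of n] unfolding vwalk_def
    by (auto simp: vwalk_arcs_append simp del: upt_Suc)
qed

lemma vwalk_relpow:
  assumes "vwalk p G"
  shows "(hd p, last p) \<in> arcs_ends G ^^ vwalk_length p"
  using assms by (induction rule: vwalk_induct) 
    (auto intro: relpow_Suc_I2 relpow_0_I simp del: relpow.simps)

lemma cf_convergent_nicf_digit: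
  "cf_convergent (nicf_digit a z) n = cf_value (0 # map (\<lambda>k. a ((nicf_map a ^^ k) z)) [0..<n])"
proof -
  have "map (nicf_digit a z) [0..<Suc n] = nicf_digit a z 0 # map (\<lambda>k. nicf_digit a z (Suc k)) [0..<n]"
    by (simp only: upt_conv_Cons[OF zero_less_Suc] list.map map_Suc_upt[symmetric] map_map comp_def)
  then show ?thesis by (simp add: cf_convergent_def nicf_digit_def del: upt_Suc cf_value.simps)
qed

lemma cf_value_Cons_0: "cf_value (0 # cs) = ext_inverse (cf_value cs)"
  by (cases "ext_inverse (cf_value cs)") auto

lemma map_orbit_Suc:
  "map (\<lambda>k. g ((f ^^ k) x)) [0..<Suc n] = g x # map (\<lambda>k. g ((f ^^ k) (f x))) [0..<n]"
  by (simp only: upt_conv_Cons[OF zero_less_Suc] list.map map_Suc_upt[symmetric] map_map comp_def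
      funpow_Suc_right funpow_0)

lemma nicf_map_domain:
  assumes "nearest_int_choice d a" "z \<in> cf_domain d"
  shows "(nicf_map a ^^ k) z \<in> cf_domain d"
  using assms(2) by (induction k) (use assms(1) in \<open>auto simp: nicf_map_def nearest_int_choice_def\<close>)

lemma cf_value_terminating:
  assumes "(nicf_map a ^^ n) z = 0"
  shows "\<forall>k<n. (nicf_map a ^^ k) z \<noteq> 0 \<Longrightarrow>
    cf_value (0 # map (\<lambda>k. a ((nicf_map a ^^ k) z)) [0..<n]) = Fin z"
  using assms
proof (induction n arbitrary: z)
  case 0
  then show ?case by simp
next
  case (Suc n)
  have "z \<noteq> 0" using Suc.prems(1) by force
  have "\<forall>k<n. (nicf_map a ^^ k) (nicf_map a z) \<noteq> 0"
    using Suc.prems(1) by (metis Suc_mono comp_apply funpow_Suc_right)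
  then have "ext_inverse (cf_value (map (\<lambda>k. a ((nicf_map a ^^ k) (nicf_map a z))) [0..<n]))
      = Fin (nicf_map a z)"
    using Suc.IH[of "nicf_map a z"] Suc.prems(2) unfolding cf_value_Cons_0
    by (simp add: funpow_Suc_right del: funpow.simps)
  then show ?case
    using \<open>z \<noteq> 0\<close> unfolding map_orbit_Suc cf_value_Cons_0 by (simp add: nicf_map_def)
qed

text \<open>Any admissible digit function is one way of breaking the ties, so its convergents fall
  under \<open>nicf\<close>.\<close>

lemma (in nicf_setting) cf_value_nicf:
  assumes "nearest_int_choice d a" "z \<in> cf_domain d" "\<forall>k<n. (nicf_map a ^^ k) z \<noteq> 0"
  shows "\<exists>t. nicf d z n t \<and> cf_value (0 # map (\<lambda>k. a ((nicf_map a ^^ k) z)) [0..<n]) = Fin t"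
  using assms(2,3)
proof (induction n arbitrary: z)
  case 0
  then show ?case using cf_domain_subset nicf_0 by force
next
  case (Suc n)
  have "z \<noteq> 0" using Suc.prems(2) by force
  have dom: "nicf_map a z \<in> cf_domain d" and az: "a z \<in> quad_ints d"
    using nicf_map_domain[OF assms(1) Suc.prems(1), of 1] assms(1) Suc.prems(1) \<open>z \<noteq> 0\<close>
    by (auto simp: nearest_int_choice_def)
  have "\<forall>k<n. (nicf_map a ^^ k) (nicf_map a z) \<noteq> 0"
    using Suc.prems(2) by (metis Suc_mono comp_apply funpow_Suc_right)
  then obtain t where t: "nicf d (nicf_map a z) n t"
    "ext_inverse (cf_value (map (\<lambda>k. a ((nicf_map a ^^ k) (nicf_map a z))) [0..<n])) = Fin t"
    using Suc.IH[OF dom] unfolding cf_value_Cons_0 by blast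
  have zc: "z \<in> voronoi_cell d" using Suc.prems(1) cf_domain_subset by blast
  have nt: "nicf d (1 / z - a z) n t" using t(1) \<open>z \<noteq> 0\<close> by (simp add: nicf_map_def)
  have "a z + t \<noteq> 0" using nicf_digit_nonzero[OF zc \<open>z \<noteq> 0\<close> az nt] .
  moreover have "nicf d z (Suc n) (1 / (a z + t))"
    using zc \<open>z \<noteq> 0\<close> az nt by (rule nicf_Suc)
  ultimately show ?case
    using t(2) unfolding map_orbit_Suc cf_value_Cons_0 by (intro exI[of _ "1 / (a z + t)"]) simp
qed

lemma nicf_length_nonzero:
  assumes "enat n \<le> nicf_length a z" "k < n"
  shows "(nicf_map a ^^ k) z \<noteq> 0"
  using assms not_less_Least[of k "\<lambda>n. (nicf_map a ^^ n) z = 0"]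
  by (auto simp: nicf_length_def split: if_splits)

theorem theorem5:
  fixes d :: nat and a :: "complex \<Rightarrow> complex" and z :: complex
  assumes "d \<in> {1, 2, 3}"
    and "nearest_int_choice d a"
    and "z \<in> cf_domain d"
  shows "geodesic_cf_expansion d z (nicf_digit a z) (nicf_length a z)"
proof -
  interpret nicf_setting d using assms(1) by unfold_locales
  let ?c = "nicf_digit a z" and ?N = "nicf_length a z"
  have digit: "?c n \<in> quad_ints d" if "enat n \<le> ?N" for n
    using nicf_length_nonzero[OF that, of "n - 1"] nicf_map_domain[OF assms(2,3), of "n - 1"] assms(2)
    by (auto simp: nicf_digit_def nearest_int_choice_def)
  have convergent: "\<exists>t. nicf d z n t \<and> cf_convergent ?c n = Fin t" if "enat n \<le> ?N" for n
    unfolding cf_convergent_nicf_digit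
    using cf_value_nicf[OF assms(2,3)] nicf_length_nonzero[OF that] by blast
  have "cf_expansion d z ?c ?N"
  proof (cases ?N)
    case (enat m)
    then have "(nicf_map a ^^ m) z = 0"
      using LeastI_ex[of "\<lambda>n. (nicf_map a ^^ n) z = 0"]
      by (auto simp: nicf_length_def split: if_splits)
    then have "cf_convergent ?c m = Fin z"
      unfolding cf_convergent_nicf_digit
      using cf_value_terminating nicf_length_nonzero[of m a z] enat by simp
    then show ?thesis using digit enat by (simp add: cf_expansion_def)
  next
    case infinity
    have "\<forall>\<^sub>F n in sequentially. \<exists>w. cf_convergent ?c n = Fin w \<and> dist w z < e" if "e > 0" for e
    proof -
      have "(\<lambda>n. sqrt (3 / 4) ^ n) \<longlonglongrightarrow> 0"
        by (rule LIMSEQ_power_zero) simp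
      then have "\<forall>\<^sub>F n in sequentially. sqrt (3 / 4) ^ n < e"
        using that by (rule order_tendstoD)
      then show ?thesis
      proof (rule eventually_mono)
        fix n assume "sqrt (3 / 4) ^ n < e"
        then show "\<exists>w. cf_convergent ?c n = Fin w \<and> dist w z < e"
          using convergent[of n] infinity nicf_dist by (metis enat_ord_simps(3) le_less_trans)
      qed
    qed
    then show ?thesis using digit infinity by (simp add: cf_expansion_def)
  qed
  moreover have "geodesic_path (farey_graph d) (Infty # map (cf_convergent ?c) [0..<Suc n])"
    if n: "enat n \<le> ?N" for n
  proof -
    \<comment> \<open>The shift puts infinity, the value of the empty fraction, at index 0 and the
      \<open>k\<close>-th convergent at \<open>Suc k\<close>.\<close>
    define f where "f k = cf_value (map ?c [0..<k])" for k
    have path: "Infty # map (cf_convergent ?c) [0..<Suc n] = map f [0..<Suc (Suc n)]"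
    proof -
      have "map f [0..<Suc (Suc n)] = f 0 # map (\<lambda>k. f (Suc k)) [0..<Suc n]"
        by (simp only: upt_conv_Cons[OF zero_less_Suc] list.map map_Suc_upt[symmetric] map_map comp_def)
      then show ?thesis by (simp add: f_def cf_convergent_def[abs_def])
    qed
    have le: "enat k \<le> ?N" if "k \<le> n" for k
      using n that by (meson enat_ord_simps(1) order_trans)
    have adj: "(f k, f (Suc k)) \<in> farey_adj d" if "k < Suc n" for k
      unfolding f_def using digit le that by (auto intro!: cf_value_adj)
    have "f k \<in> verts (farey_graph d)" if "k \<le> Suc n" for k
      using adj[of k] adj[of "k - 1"] farey_adj_vertices that by (cases k) auto
    then have "vwalk (map f [0..<Suc (Suc n)]) (farey_graph d)"
      using adj by (intro vwalk_map_upt)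
    moreover have "vwalk_length (map f [0..<Suc (Suc n)]) \<le> vwalk_length q"
      if q: "vwalk q (farey_graph d)" "hd q = hd (map f [0..<Suc (Suc n)])"
        "last q = last (map f [0..<Suc (Suc n)])" for q
    proof -
      obtain t where t: "nicf d z n t" "cf_convergent ?c n = Fin t" using convergent n by blast
      have "hd q = Infty" using q(2) unfolding path[symmetric] by simp
      moreover have "last q = Fin t" using q(3) t(2) unfolding path[symmetric] by simp
      \<comment> \<open>The path has \<open>n + 2\<close> vertices, hence length
        \<open>Suc n\<close>, which is the lower bound for walks from infinity to
        \<open>t\<close>.\<close>
      ultimately show ?thesis
        using nicf_walk_length[OF t(1)] vwalk_relpow[OF q(1)] by simp
    qed
    ultimately show ?thesis unfolding path geodesic_path_def by blast
  qed
  ultimately show ?thesis by (simp add: geodesic_cf_expansion_def)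
qed

end
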